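(* Let $E$ and $F$ be nonzero Banach lattices. Then the following assertions are equivalent: (1) Every order bounded operator $T : E \to F$ is order M-weakly compact. (2) The norm of $E'$ is order continuous.
   Context: All Banach lattices are real; "operator" means bounded linear map; $G'$ denotes the topological dual (a Banach lattice when $G$ is one), and $B_G$ the closed unit ball of $G$. An operator between Banach lattices is order bounded if it maps order bounded sets to order bounded sets. An operator $T : E \to F$ between Banach lattices is order M-weakly compact if $f_n(T(x_n))\to 0$ for every disjoint sequence $(x_n)$ in $B_E$ and every order bounded sequence $(f_n)$ of $F'$. *)

theory Defs
  imports "HOL-Analysis.Analysis" "HOL-Library.Lattice_Algebras"
begin

class banach_lattice = banach + ordered_real_vector + lattice_ab_group_add_abs +
  assumes norm_lattice_mono: "\<bar>x\<bar> \<le> \<bar>y\<bar> \<Longrightarrow> norm x \<le> norm y"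

instance real :: banach_lattice
  by standard simp

text \<open>
  The pointwise order on the positive cone. Taking the codomain \<open>real\<close> gives the order of the
  dual \<open>'a \<Rightarrow>\<^sub>L real\<close> of a Banach lattice; the norm of the dual is the operator norm that
  \<open>blinfun\<close> already carries. The lattice operations of the dual are determined by this order and
  are not needed below.
\<close>

instantiation blinfun ::
  (banach_lattice, "{real_normed_vector, ordered_real_vector}") ordered_real_vector
begin

definition less_eq_blinfun :: "'a \<Rightarrow>\<^sub>L 'b \<Rightarrow> 'a \<Rightarrow>\<^sub>L 'b \<Rightarrow> bool" where
  "less_eq_blinfun f g \<longleftrightarrow> (\<forall>x\<ge>0. blinfun_apply f x \<le> blinfun_apply g x)"

definition less_blinfun :: "'a \<Rightarrow>\<^sub>L 'b \<Rightarrow> 'a \<Rightarrow>\<^sub>L 'b \<Rightarrow> bool" where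
  "less_blinfun f g \<longleftrightarrow> f \<le> g \<and> \<not> g \<le> f"

instance
proof
  fix f g h :: "'a \<Rightarrow>\<^sub>L 'b" and a b :: real
  show "f < g \<longleftrightarrow> f \<le> g \<and> \<not> g \<le> f" by (rule less_blinfun_def)
  show "f \<le> f" by (simp add: less_eq_blinfun_def)
  show "f \<le> h" if "f \<le> g" "g \<le> h"
    using that unfolding less_eq_blinfun_def by (meson order_trans)
  show "f = g" if "f \<le> g" "g \<le> f"
  proof (rule blinfun_eqI)
    fix x :: 'a
    have pos: "blinfun_apply f y = blinfun_apply g y" if "0 \<le> y" for y
      using \<open>f \<le> g\<close> \<open>g \<le> f\<close> that unfolding less_eq_blinfun_def by (meson order_antisym)
    have "x = pprt x - (- nprt x)" using prts[of x] by simp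
    moreover have "blinfun_apply f (pprt x) = blinfun_apply g (pprt x)"
      by (rule pos) simp
    moreover have "blinfun_apply f (- nprt x) = blinfun_apply g (- nprt x)"
      by (rule pos) simp
    ultimately show "blinfun_apply f x = blinfun_apply g x"
      by (metis blinfun.diff_right)
  qed
  show "h + f \<le> h + g" if "f \<le> g"
    using that by (simp add: less_eq_blinfun_def blinfun.add_left)
  show "a *\<^sub>R f \<le> a *\<^sub>R g" if "f \<le> g" "0 \<le> a"
    using that by (simp add: less_eq_blinfun_def blinfun.scaleR_left scaleR_left_mono)
  show "a *\<^sub>R f \<le> b *\<^sub>R f" if "a \<le> b" "0 \<le> f"
    using that by (simp add: less_eq_blinfun_def blinfun.scaleR_left scaleR_right_mono)
qed

end

definition order_bounded :: "'a::order set \<Rightarrow> bool" where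
  "order_bounded A \<longleftrightarrow> (\<exists>a b. A \<subseteq> {a..b})"

definition order_bounded_operator :: "('a::banach_lattice \<Rightarrow>\<^sub>L 'b::banach_lattice) \<Rightarrow> bool" where
  "order_bounded_operator T \<longleftrightarrow>
     (\<forall>A. order_bounded A \<longrightarrow> order_bounded (blinfun_apply T ` A))"

definition disjoint_sequence :: "(nat \<Rightarrow> 'a::banach_lattice) \<Rightarrow> bool" where
  "disjoint_sequence x \<longleftrightarrow> (\<forall>m n. m \<noteq> n \<longrightarrow> inf \<bar>x m\<bar> \<bar>x n\<bar> = 0)"

definition order_M_weakly_compact :: "('a::banach_lattice \<Rightarrow>\<^sub>L 'b::banach_lattice) \<Rightarrow> bool" where
  "order_M_weakly_compact T \<longleftrightarrow>
     (\<forall>(x :: nat \<Rightarrow> 'a) (f :: nat \<Rightarrow> 'b \<Rightarrow>\<^sub>L real).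
        disjoint_sequence x \<and> range x \<subseteq> cball 0 1 \<and> order_bounded (range f) \<longrightarrow>
        (\<lambda>n. blinfun_apply (f n) (blinfun_apply T (x n))) \<longlonglongrightarrow> 0)"

text \<open>
  Order continuity of the norm: every net decreasing to \<open>0\<close> converges to \<open>0\<close> in norm. Since one
  cannot quantify over the type of the index set, the definition uses the nets given by a downward
  directed set indexed by itself; the lemma below shows that this covers decreasing nets over
  index sets of any type.
\<close>

definition order_continuous_norm ::
  "'a::{real_normed_vector, ordered_real_vector} itself \<Rightarrow> bool" where
  "order_continuous_norm _ \<longleftrightarrow>
     (\<forall>D :: 'a set.
        D \<noteq> {} \<and> (\<forall>x\<in>D. \<forall>y\<in>D. \<exists>z\<in>D. z \<le> x \<and> z \<le> y) \<and>
        (\<forall>x\<in>D. 0 \<le> x) \<and> (\<forall>l. (\<forall>x\<in>D. l \<le> x) \<longrightarrow> l \<le> 0) \<longrightarrow>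
        (\<forall>e>0. \<exists>d\<in>D. \<forall>x\<in>D. x \<le> d \<longrightarrow> norm x < e))"

lemma order_continuous_norm_net:
  fixes x :: "'i \<Rightarrow> 'a::{real_normed_vector, ordered_real_vector}"
  assumes cont: "order_continuous_norm TYPE('a)"
    and "I \<noteq> {}" and dir: "\<And>i j. i \<in> I \<Longrightarrow> j \<in> I \<Longrightarrow> \<exists>k\<in>I. r i k \<and> r j k"
    and decr: "\<And>i j. i \<in> I \<Longrightarrow> j \<in> I \<Longrightarrow> r i j \<Longrightarrow> x j \<le> x i"
    and nonneg: "\<And>i. i \<in> I \<Longrightarrow> 0 \<le> x i" and glb: "\<And>l. (\<And>i. i \<in> I \<Longrightarrow> l \<le> x i) \<Longrightarrow> l \<le> 0"
    and "e > 0"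
  shows "\<exists>i\<in>I. \<forall>j\<in>I. r i j \<longrightarrow> norm (x j) < e"
proof -
  let ?D = "x ` I"
  have nonempty: "?D \<noteq> {}" using \<open>I \<noteq> {}\<close> by blast
  have directed: "\<forall>a\<in>?D. \<forall>b\<in>?D. \<exists>c\<in>?D. c \<le> a \<and> c \<le> b"
  proof (intro ballI)
    fix a b assume "a \<in> ?D" "b \<in> ?D"
    then obtain i j where ij: "i \<in> I" "j \<in> I" "a = x i" "b = x j" by blast
    then obtain k where k: "k \<in> I" "r i k" "r j k" using dir by blast
    have "x k \<le> a" "x k \<le> b" using decr ij k by simp_all
    then show "\<exists>c\<in>?D. c \<le> a \<and> c \<le> b" using k(1) by blast
  qed
  have lower: "\<forall>a\<in>?D. 0 \<le> a" using nonneg by blast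
  have greatest: "\<forall>l. (\<forall>a\<in>?D. l \<le> a) \<longrightarrow> l \<le> 0"
  proof (intro allI impI)
    fix l assume "\<forall>a\<in>?D. l \<le> a"
    then have "l \<le> x i" if "i \<in> I" for i using that by blast
    then show "l \<le> 0" by (rule glb)
  qed
  have "\<forall>e>0. \<exists>d\<in>?D. \<forall>a\<in>?D. a \<le> d \<longrightarrow> norm a < e"
    using cont[unfolded order_continuous_norm_def, THEN spec, of ?D]
      nonempty directed lower greatest by (elim mp) (intro conjI)
  then obtain i where i: "i \<in> I" "\<forall>a\<in>?D. a \<le> x i \<longrightarrow> norm a < e"
    using \<open>e > 0\<close> by blast
  have "norm (x j) < e" if "j \<in> I" "r i j" for j
    using i(2) decr[OF i(1) that] that(1) by blast
  then show ?thesis using i(1) by blast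
qed

end

theory Submission
  imports Defs
begin

text \<open>
  Both implications pass through bounded disjoint sequences. If (1) holds, then the rank one
  operators \<open>x \<mapsto> f x \<cdot> y\<close> show that every functional \<open>f\<close> on \<open>E\<close> tends to \<open>0\<close> along every bounded
  disjoint sequence. If the norm of \<open>E'\<close> were not order continuous, a set directed downwards to
  \<open>0\<close> (hence pointwise on the positive cone) with norms at least \<open>e\<close> would yield
  \<open>d\<^sub>0 \<ge> d\<^sub>1 \<ge> \<dots>\<close> and positive \<open>x\<^sub>n\<close> in the unit ball with \<open>d\<^sub>n x\<^sub>n > e/2\<close> but
  \<open>4\<^sup>n d\<^sub>n (x\<^sub>0 + \<dots> + x\<^bsub>n-1\<^esub>)\<close> small; the disjoint sequence
  \<open>(x\<^sub>n - 4\<^sup>n (x\<^sub>0 + \<dots> + x\<^bsub>n-1\<^esub>) - 2\<^sup>-\<^sup>n X)\<^sup>+\<close> with \<open>X = \<Sum> 2\<^sup>-\<^sup>i x\<^sub>i\<close> then contradicts \<open>d\<^sub>0\<close> tending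
  to \<open>0\<close> along it.

  Conversely, given \<open>T\<close>, \<open>x\<^sub>n\<close> and \<open>f\<^sub>n\<close>, let \<open>k\<^sub>n\<close> be the modulus of \<open>f\<^sub>n \<circ> T\<close> restricted to the
  ideal generated by \<open>x\<^sub>n\<close>. Since \<open>T\<close> is order bounded and these ideals are disjoint, the partial
  sums of \<open>\<Sum> k\<^sub>n\<close> are pointwise bounded, so the remainders of the series decrease to \<open>0\<close> in \<open>E'\<close>.
  Order continuity gives \<open>norm k\<^sub>n \<rightarrow> 0\<close>, and \<open>\<bar>f\<^sub>n (T x\<^sub>n)\<bar> \<le> norm k\<^sub>n\<close>.
\<close>

section \<open>Existence of nonzero functionals\<close>

text \<open>Homogeneity is required only for \<open>c > 0\<close>; the value at \<open>0\<close> is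
  then forced to be \<open>0\<close>, since \<open>q 0 = 2 * q 0\<close>.\<close>

definition sublinear :: "('a::real_vector \<Rightarrow> real) \<Rightarrow> bool" where
  "sublinear q \<longleftrightarrow> (\<forall>x y. q (x + y) \<le> q x + q y) \<and> (\<forall>c>0. \<forall>x. q (c *\<^sub>R x) = c * q x)"

lemma sublinear_add: "sublinear q \<Longrightarrow> q (x + y) \<le> q x + q y"
  and sublinear_scaleR: "sublinear q \<Longrightarrow> 0 < c \<Longrightarrow> q (c *\<^sub>R x) = c * q x"
  by (simp_all add: sublinear_def)

lemma sublinear_0: "sublinear q \<Longrightarrow> q 0 = 0"
  using sublinear_scaleR[of q 2 0] by simp

lemma sublinear_minus: "sublinear q \<Longrightarrow> - q (- x) \<le> q x"
  using sublinear_add[of q x "- x"] sublinear_0[of q] by simp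

text \<open>The one-sided scaling bound, applied to \<open>inverse c\<close> and
  \<open>c *\<^sub>R x\<close>, yields the opposite bound.\<close>

lemma sublinearI:
  assumes add: "\<And>x y. q (x + y) \<le> q x + q y"
    and scale: "\<And>c x. 0 < c \<Longrightarrow> q (c *\<^sub>R x) \<le> c * q x"
  shows "sublinear q"
  unfolding sublinear_def
proof (intro conjI allI impI add)
  fix c :: real and x assume c: "0 < c"
  have "q (inverse c *\<^sub>R c *\<^sub>R x) \<le> inverse c * q (c *\<^sub>R x)" using c by (intro scale) simp
  then have "c * q x \<le> q (c *\<^sub>R x)" using c by (simp add: field_simps)
  then show "q (c *\<^sub>R x) = c * q x" using scale[OF c] by (simp add: order_antisym)
qed

text \<open>This is the Hahn-Banach step: \<open>r\<close> is built as the largest sublinear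
  functional below \<open>q\<close> whose value at \<open>- a\<close> is at most
  \<open>- q a\<close>. It forces minimal functionals to be odd and prescribes the size of a
  functional at a given vector.\<close>

lemma sublinear_tilt:
  assumes q: "sublinear q"
  obtains r where "sublinear r" "\<And>x. r x \<le> q x" "r (- a) \<le> - q a"
proof -
  define r where "r x = (INF t\<in>{0..}. q (x + t *\<^sub>R a) - t * q a)" for x
  \<comment> \<open>This lower bound, uniform in \<open>t\<close>, keeps the infimum finite.\<close>
  have "- q (- x) \<le> q (x + t *\<^sub>R a) - t * q a" if "0 \<le> t" for x t
  proof -
    have "t * q a = q (t *\<^sub>R a)"
      using that sublinear_scaleR[OF q] sublinear_0[OF q] by (cases "t = 0") simp_all
    also have "\<dots> \<le> q (x + t *\<^sub>R a) + q (- x)" using sublinear_add[OF q, of "x + t *\<^sub>R a" "- x"] by simp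
    finally show ?thesis by simp
  qed
  then have bdd: "bdd_below ((\<lambda>t. q (x + t *\<^sub>R a) - t * q a) ` {0..})" for x
    by (intro bdd_belowI2[of _ "- q (- x)"]) simp
  have lower: "r x \<le> q (x + t *\<^sub>R a) - t * q a" if "0 \<le> t" for x t
    unfolding r_def using that by (intro cINF_lower bdd) simp
  have greatest: "c \<le> r x" if "\<And>t. 0 \<le> t \<Longrightarrow> c \<le> q (x + t *\<^sub>R a) - t * q a" for c x
    unfolding r_def using that by (intro cINF_greatest) auto
  have "sublinear r"
  proof (rule sublinearI)
    fix x y
    \<comment> \<open>A parameter \<open>t\<close> for \<open>x\<close> and a parameter
      \<open>u\<close> for \<open>y\<close> combine to \<open>t + u\<close> for
      \<open>x + y\<close>; the two infima are then taken one after the other.\<close>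
    have "r (x + y) - (q (y + u *\<^sub>R a) - u * q a) \<le> r x" if u: "0 \<le> u" for u
    proof (rule greatest)
      fix t :: real assume t: "0 \<le> t"
      have "r (x + y) \<le> q ((x + y) + (t + u) *\<^sub>R a) - (t + u) * q a" using t u by (intro lower) simp
      also have "(x + y) + (t + u) *\<^sub>R a = (x + t *\<^sub>R a) + (y + u *\<^sub>R a)"
        by (simp add: algebra_simps)
      also have "q \<dots> \<le> q (x + t *\<^sub>R a) + q (y + u *\<^sub>R a)" by (rule sublinear_add[OF q])
      finally show "r (x + y) - (q (y + u *\<^sub>R a) - u * q a) \<le> q (x + t *\<^sub>R a) - t * q a"
        by (simp add: algebra_simps)
    qed
    then have "r (x + y) - r x \<le> r y" by (intro greatest) (simp add: algebra_simps)
    then show "r (x + y) \<le> r x + r y" by simp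
  next
    fix c :: real and x assume c: "0 < c"
    have "r (c *\<^sub>R x) / c \<le> r x"
    proof (rule greatest)
      fix t :: real assume t: "0 \<le> t"
      have "r (c *\<^sub>R x) \<le> q (c *\<^sub>R x + (c * t) *\<^sub>R a) - (c * t) * q a" using c t by (intro lower) simp
      also have "c *\<^sub>R x + (c * t) *\<^sub>R a = c *\<^sub>R (x + t *\<^sub>R a)" by (simp add: scaleR_add_right)
      also have "q \<dots> = c * q (x + t *\<^sub>R a)" by (rule sublinear_scaleR[OF q c])
      finally show "r (c *\<^sub>R x) / c \<le> q (x + t *\<^sub>R a) - t * q a" using c by (simp add: field_simps)
    qed
    then show "r (c *\<^sub>R x) \<le> c * r x" using c by (simp add: field_simps)
  qed
  moreover have "r x \<le> q x" for x using lower[of 0 x] by simp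
  moreover have "r (- a) \<le> - q a" using lower[of 1 "- a"] sublinear_0[OF q] by simp
  ultimately show thesis using that by blast
qed

text \<open>Zorn's lemma for the reversed pointwise order: the pointwise infimum of a nonempty chain
  is finite because each member is at least \<open>- p (- x)\<close> at \<open>x\<close>.\<close>

lemma sublinear_minimal:
  assumes p: "sublinear p"
  obtains q where "sublinear q" "q \<le> p" "\<And>r. sublinear r \<Longrightarrow> r \<le> q \<Longrightarrow> r = q"
proof -
  define A where "A = {q. sublinear q \<and> q \<le> p}"
  have "\<exists>q\<in>A. \<forall>r\<in>A. q \<ge> r \<longrightarrow> r = q"
  proof (rule predicate_Zorn)
    show "partial_order_on A (relation_of (\<ge>) A)"
      by (rule partial_order_on_relation_ofI) auto
    fix C assume "C \<in> Chains (relation_of (\<ge>) A)"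
    then have CA: "C \<subseteq> A" and chain: "\<And>q r. q \<in> C \<Longrightarrow> r \<in> C \<Longrightarrow> q \<le> r \<or> r \<le> q"
      by (auto simp: Chains_def relation_of_def)
    show "\<exists>u\<in>A. \<forall>a\<in>C. a \<ge> u"
    proof (cases "C = {}")
      case True
      then show ?thesis using p by (auto simp: A_def)
    next
      case False
      define u where "u x = (INF q\<in>C. q x)" for x
      have sub: "sublinear q" and le_p: "q x \<le> p x" if "q \<in> C" for q x
        using that CA by (auto simp: A_def le_fun_def)
      have "- p (- x) \<le> q x" if "q \<in> C" for q x
        using sublinear_minus[OF sub[OF that], of x] le_p[OF that, of "- x"] by simp
      then have lower: "u x \<le> q x" if "q \<in> C" for q x
        unfolding u_def using that by (intro cINF_lower bdd_belowI2[of _ "- p (- x)"])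
      have greatest: "c \<le> u x" if "\<And>q. q \<in> C \<Longrightarrow> c \<le> q x" for c x
        unfolding u_def using False that by (rule cINF_greatest)
      have "sublinear u"
      proof (rule sublinearI)
        fix x y
        have "u (x + y) - r y \<le> u x" if r: "r \<in> C" for r
        proof (rule greatest)
          fix q assume q: "q \<in> C"
          \<comment> \<open>Subadditivity of the infimum mixes two members of the chain; the smaller
            of them serves both arguments.\<close>
          then obtain s where s: "s \<in> C" "s \<le> q" "s \<le> r" using chain[OF q r] r by blast
          have "u (x + y) \<le> s x + s y"
            using lower[OF s(1)] sublinear_add[OF sub[OF s(1)]] order_trans by blast
          also have "\<dots> \<le> q x + r y" using s by (intro add_mono) (auto simp: le_fun_def)
          finally show "u (x + y) - r y \<le> q x" by simp
        qed
        then have "u (x + y) - u x \<le> u y" by (intro greatest) (simp add: algebra_simps)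
        then show "u (x + y) \<le> u x + u y" by simp
      next
        fix c :: real and x assume c: "0 < c"
        have "u (c *\<^sub>R x) / c \<le> u x"
        proof (rule greatest)
          fix q assume q: "q \<in> C"
          show "u (c *\<^sub>R x) / c \<le> q x"
            using lower[OF q, of "c *\<^sub>R x"] sublinear_scaleR[OF sub[OF q] c] c by (simp add: field_simps)
        qed
        then show "u (c *\<^sub>R x) \<le> c * u x" using c by (simp add: field_simps)
      qed
      moreover have "u \<le> p"
        using False lower le_p by (meson all_not_in_conv le_funI order_trans)
      ultimately show ?thesis using lower by (auto simp: A_def le_fun_def)
    qed
  qed
  then obtain q where "q \<in> A" "\<And>r. r \<in> A \<Longrightarrow> r \<le> q \<Longrightarrow> r = q" by blast
  then show thesis by (intro that) (auto simp: A_def)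
qed

text \<open>A minimal sublinear functional is not changed by tilting, hence is odd, hence linear.\<close>

lemma sublinear_dominates_linear:
  assumes "sublinear p"
  obtains f where "linear f" "\<And>x. f x \<le> p x"
proof -
  obtain q where q: "sublinear q" "q \<le> p" and min: "\<And>r. sublinear r \<Longrightarrow> r \<le> q \<Longrightarrow> r = q"
    using sublinear_minimal[OF assms] by blast
  have odd: "q (- a) = - q a" for a
  proof -
    obtain r where "sublinear r" "\<And>x. r x \<le> q x" "r (- a) \<le> - q a"
      using sublinear_tilt[OF q(1)] by blast
    then have "q (- a) \<le> - q a" using min[of r] by (simp add: le_fun_def)
    then show ?thesis using sublinear_minus[OF q(1), of a] by simp
  qed
  have "linear q"
  proof (rule linearI)
    fix x y
    have "q (- x + - y) \<le> q (- x) + q (- y)" by (rule sublinear_add[OF q(1)])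
    then show "q (x + y) = q x + q y"
      using odd[of "x + y"] odd[of x] odd[of y] sublinear_add[OF q(1), of x y] by simp
  next
    fix c :: real and x
    consider "c = 0" | "0 < c" | "0 < - c" by linarith
    then show "q (c *\<^sub>R x) = c *\<^sub>R q x"
    proof cases
      case 3
      then show ?thesis using sublinear_scaleR[OF q(1) 3, of x] odd[of "c *\<^sub>R x"] by simp
    qed (use q(1) in \<open>simp_all add: sublinear_0 sublinear_scaleR\<close>)
  qed
  then show thesis using that q(2) by (auto simp: le_fun_def)
qed

text \<open>After tilting the norm along \<open>y\<close>, a linear \<open>f\<close> below the
  tilted functional satisfies \<open>f (- y) \<le> - norm y\<close> and is therefore nonzero at
  \<open>y\<close>, while \<open>f x \<le> norm x\<close> makes it bounded.\<close>

lemma nonzero_functional: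
  fixes y :: "'a::real_normed_vector"
  assumes "y \<noteq> 0"
  shows "\<exists>g :: 'a \<Rightarrow>\<^sub>L real. blinfun_apply g y \<noteq> 0"
proof -
  have "sublinear (norm :: 'a \<Rightarrow> real)" by (rule sublinearI) (simp_all add: norm_triangle_ineq)
  then obtain p where p: "sublinear p" "\<And>x::'a. p x \<le> norm x" "p (- y) \<le> - norm y"
    using sublinear_tilt by blast
  obtain f where f: "linear f" "\<And>x. f x \<le> p x" using sublinear_dominates_linear[OF p(1)] by blast
  have f_le: "f x \<le> norm x" for x using f(2) p(2) order_trans by blast
  have "\<bar>f x\<bar> \<le> norm x * 1" for x
    using f_le[of x] f_le[of "- x"] linear_neg[OF f(1), of x] by simp
  then have "bounded_linear f"
    using f(1) by (intro bounded_linear_intro[where K=1]) (simp_all add: linear_add linear_scale)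
  moreover have "f y \<noteq> 0"
  proof -
    have "f (- y) \<le> - norm y" using f(2) p(3) order_trans by blast
    then show ?thesis using assms linear_neg[OF f(1), of y] by auto
  qed
  ultimately show ?thesis by (metis bounded_linear_Blinfun_apply)
qed

section \<open>Banach lattices and their positive functionals\<close>

lemma abs_scaleR_nonneg:
  fixes x :: "'a::banach_lattice"
  assumes "0 \<le> c"
  shows "\<bar>c *\<^sub>R x\<bar> = c *\<^sub>R \<bar>x\<bar>"
proof (cases "c = 0")
  case False
  then have c: "0 < c" using assms by simp
  have le: "\<bar>c *\<^sub>R y\<bar> \<le> c *\<^sub>R \<bar>y\<bar>" if "0 < c" for c and y :: 'a
  proof (rule abs_leI)
    show "c *\<^sub>R y \<le> c *\<^sub>R \<bar>y\<bar>"
      using that by (intro scaleR_left_mono abs_ge_self) simp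
    have "c *\<^sub>R (- y) \<le> c *\<^sub>R \<bar>y\<bar>"
      using that by (intro scaleR_left_mono abs_ge_minus_self) simp
    then show "- (c *\<^sub>R y) \<le> c *\<^sub>R \<bar>y\<bar>" by simp
  qed
  have "inverse c *\<^sub>R (c *\<^sub>R x) = x" using c by simp
  then have "\<bar>x\<bar> \<le> inverse c *\<^sub>R \<bar>c *\<^sub>R x\<bar>"
    using le[of "inverse c" "c *\<^sub>R x"] c by simp
  then have "c *\<^sub>R \<bar>x\<bar> \<le> \<bar>c *\<^sub>R x\<bar>" using c by (simp add: pos_le_divideR_eq)
  then show ?thesis using le[OF c] by (simp add: order_antisym)
qed simp

lemma norm_mono_nonneg:
  fixes x y :: "'a::banach_lattice"
  assumes "0 \<le> x" "x \<le> y"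
  shows "norm x \<le> norm y"
proof (rule norm_lattice_mono)
  show "\<bar>x\<bar> \<le> \<bar>y\<bar>" using assms by (metis abs_of_nonneg order_trans)
qed

lemma norm_abs_lattice [simp]: "norm \<bar>x\<bar> = norm (x::'a::banach_lattice)"
  by (intro order_antisym norm_lattice_mono) simp_all

lemma pprt_le_abs: "pprt x \<le> \<bar>x::'a::banach_lattice\<bar>"
  by (simp add: pprt_def abs_ge_self)

lemma eq_pprt_diff_pprt: "(x::'a::banach_lattice) = pprt x - pprt (- x)"
  using prts[of x] by (simp add: pprt_neg)

text \<open>Once \<open>0 \<le> x n\<close>, the positive part of \<open>- l\<close> is dominated by
  \<open>\<bar>x n - l\<bar>\<close>, whose norm tends to \<open>0\<close>.\<close>

lemma nonneg_LIMSEQ: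
  fixes x :: "nat \<Rightarrow> 'a::banach_lattice"
  assumes lim: "x \<longlonglongrightarrow> l" and nonneg: "\<And>n. N \<le> n \<Longrightarrow> 0 \<le> x n"
  shows "0 \<le> l"
proof -
  have bound: "norm (pprt (- l)) \<le> norm (x n - l)" if "N \<le> n" for n
  proof -
    have "- l \<le> x n - l" using nonneg[OF that] by simp
    then have "pprt (- l) \<le> \<bar>x n - l\<bar>"
      unfolding pprt_def by (meson abs_ge_self abs_ge_zero le_supI order_trans)
    then have "norm (pprt (- l)) \<le> norm \<bar>x n - l\<bar>"
      by (rule norm_mono_nonneg[OF zero_le_pprt])
    then show ?thesis by simp
  qed
  have "(\<lambda>n. norm (x n - l)) \<longlonglongrightarrow> 0"
    using lim by (simp add: LIM_zero_iff tendsto_norm_zero)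
  then have "norm (pprt (- l)) \<le> 0"
    using bound by (intro LIMSEQ_le_const) blast+
  then have "pprt (- l) = 0" by simp
  then show ?thesis using le_zero_iff_zero_pprt[of "- l"] by simp
qed

text \<open>From \<open>N = Suc n\<close> on, the partial sums minus \<open>x n\<close> are
  positive, and the cone is closed.\<close>

lemma le_suminf_nonneg:
  fixes x :: "nat \<Rightarrow> 'a::banach_lattice"
  assumes "summable x" and nonneg: "\<And>n. 0 \<le> x n"
  shows "x n \<le> suminf x"
proof -
  have "(\<lambda>N. sum x {..<N} - x n) \<longlonglongrightarrow> suminf x - x n"
    by (intro tendsto_diff summable_LIMSEQ assms tendsto_const)
  then have "0 \<le> suminf x - x n"
  proof (rule nonneg_LIMSEQ)
    fix N assume "Suc n \<le> N"
    then have "sum x {..<N} = x n + sum x ({..<N} - {n})" by (intro sum.remove) auto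
    then show "0 \<le> sum x {..<N} - x n" using nonneg by (simp add: sum_nonneg)
  qed
  then show ?thesis by simp
qed

section \<open>Disjointness under scaling and finite sums\<close>

lemma inf_scaleR_le:
  fixes x y :: "'a::banach_lattice"
  assumes "0 < c"
  shows "inf (c *\<^sub>R x) (c *\<^sub>R y) \<le> c *\<^sub>R inf x y"
proof -
  have "inverse c *\<^sub>R inf (c *\<^sub>R x) (c *\<^sub>R y) \<le> inf x y"
    using assms by (intro le_infI) (simp_all add: pos_divideR_le_eq del: le_inf_iff)
  then show ?thesis using assms pos_divideR_le_eq by blast
qed

lemma inf_scaleR_eq_0:
  fixes u v :: "'a::banach_lattice"
  assumes "inf u v = 0" "0 \<le> u" "0 \<le> v" "0 \<le> k" "0 \<le> l"
  shows "inf (k *\<^sub>R u) (l *\<^sub>R v) = 0"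
proof (rule order_antisym)
  \<comment> \<open>A common factor above both \<open>k\<close> and \<open>l\<close>; the summand
    \<open>1\<close> keeps it positive when both vanish.\<close>
  let ?c = "k + l + 1"
  have "inf (k *\<^sub>R u) (l *\<^sub>R v) \<le> inf (?c *\<^sub>R u) (?c *\<^sub>R v)"
    using assms by (intro inf_mono scaleR_right_mono) auto
  also have "\<dots> \<le> ?c *\<^sub>R inf u v" using assms by (intro inf_scaleR_le) auto
  finally show "inf (k *\<^sub>R u) (l *\<^sub>R v) \<le> 0" using assms(1) by simp
  show "0 \<le> inf (k *\<^sub>R u) (l *\<^sub>R v)"
    using assms by (intro le_infI scaleR_nonneg_nonneg)
qed

text \<open>By distributivity the right side is the infimum of \<open>a + b\<close>,
  \<open>a + c\<close>, \<open>c + b\<close> and \<open>c + c\<close>, each of which dominates the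
  left side.\<close>

lemma inf_add_le:
  fixes a b c :: "'a::lattice_ab_group_add"
  assumes "0 \<le> a" "0 \<le> b" "0 \<le> c"
  shows "inf (a + b) c \<le> inf a c + inf b c"
proof -
  have "inf (a + b) c \<le> c + b" "inf (a + b) c \<le> a + c" "inf (a + b) c \<le> c + c"
    using assms by (intro le_infI2 add_increasing add_increasing2; simp)+
  then show ?thesis by (simp add: add_inf_distrib_left add_inf_distrib_right)
qed

lemma inf_sum_eq_0:
  fixes u :: "'i \<Rightarrow> 'a::lattice_ab_group_add"
  assumes "finite A" "\<And>i. i \<in> A \<Longrightarrow> 0 \<le> u i" "\<And>i. i \<in> A \<Longrightarrow> inf (u i) v = 0" "0 \<le> v"
  shows "inf (sum u A) v = 0"
  using assms
proof (induction A rule: finite_induct)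
  case empty
  then show ?case by (simp add: inf_absorb1)
next
  case (insert j A)
  have "inf (u j + sum u A) v \<le> inf (u j) v + inf (sum u A) v"
    using insert.prems by (intro inf_add_le sum_nonneg) auto
  also have "\<dots> = 0" using insert by simp
  finally have "inf (sum u (insert j A)) v \<le> 0" using insert.hyps by simp
  moreover have "0 \<le> inf (sum u (insert j A)) v"
    using insert.prems by (intro le_infI sum_nonneg) auto
  ultimately show ?case by (rule order_antisym)
qed

text \<open>For disjoint positive elements the sum equals the supremum.\<close>

lemma sum_disjoint_le:
  fixes u :: "'i \<Rightarrow> 'a::lattice_ab_group_add"
  assumes "finite A" "\<And>i. i \<in> A \<Longrightarrow> 0 \<le> u i" "\<And>i. i \<in> A \<Longrightarrow> u i \<le> x"
    and "\<And>i j. i \<in> A \<Longrightarrow> j \<in> A \<Longrightarrow> i \<noteq> j \<Longrightarrow> inf (u i) (u j) = 0" "0 \<le> x"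
  shows "sum u A \<le> x"
  using assms
proof (induction A rule: finite_induct)
  case (insert j A)
  have disj: "inf (sum u A) (u j) = 0"
    using insert.prems insert.hyps by (intro inf_sum_eq_0) auto
  have "sum u (insert j A) = sum u A + u j" using insert.hyps by (simp add: add.commute)
  also have "\<dots> = sup (sum u A) (u j)" using disj by (subst add_eq_inf_sup) simp
  also have "\<dots> \<le> x" using insert by (intro le_supI) auto
  finally show ?case .
qed simp

text \<open>Induction on \<open>A\<close>: for each fixed sign \<open>e\<close> of the new term the
  hypothesis applies with bound \<open>b - e *\<^sub>R y j\<close>, and the two signs together bound
  \<open>\<bar>y j\<bar>\<close>.\<close>

lemma sum_abs_le_of_signed_sums:
  fixes y :: "'i \<Rightarrow> 'a::banach_lattice"
  assumes "finite A"
    and "\<And>s. (\<And>i. s i \<in> {-1, 1}) \<Longrightarrow> (\<Sum>i\<in>A. s i *\<^sub>R y i) \<le> b"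
  shows "(\<Sum>i\<in>A. \<bar>y i\<bar>) \<le> b"
  using assms
proof (induction A arbitrary: b rule: finite_induct)
  case empty
  then show ?case using empty.prems[of "\<lambda>_. 1"] by simp
next
  case (insert j A)
  have le: "(\<Sum>i\<in>A. \<bar>y i\<bar>) \<le> b - e *\<^sub>R y j" if e: "e \<in> {-1, 1}" for e :: real
  proof (rule insert.IH)
    fix s :: "'i \<Rightarrow> real" assume s: "\<And>i. s i \<in> {-1, 1}"
    have "(\<Sum>i\<in>insert j A. (s(j := e)) i *\<^sub>R y i) \<le> b"
      using s e by (intro insert.prems) auto
    moreover have "(\<Sum>i\<in>A. (s(j := e)) i *\<^sub>R y i) = (\<Sum>i\<in>A. s i *\<^sub>R y i)"
      using insert.hyps by (intro sum.cong) auto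
    ultimately show "(\<Sum>i\<in>A. s i *\<^sub>R y i) \<le> b - e *\<^sub>R y j"
      using insert.hyps by (simp add: le_diff_eq add.commute)
  qed
  have "\<bar>y j\<bar> \<le> b - (\<Sum>i\<in>A. \<bar>y i\<bar>)"
    using le[of 1] le[of "-1"] by (intro abs_leI) (simp_all add: algebra_simps)
  then show ?case using insert.hyps by (simp add: le_diff_eq)
qed

section \<open>Extending additive functions from the positive cone\<close>

text \<open>If no \<open>C\<close> works, suitably rescaled counterexamples form a convergent series
  of positive vectors, and monotonicity makes \<open>p\<close> of its sum exceed every
  bound.\<close>

lemma nonneg_bounded_on_cone:
  fixes p :: "'a::banach_lattice \<Rightarrow> real"
  assumes mono: "\<And>x y. 0 \<le> x \<Longrightarrow> x \<le> y \<Longrightarrow> p x \<le> p y"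
    and hom: "\<And>c x. 0 < c \<Longrightarrow> 0 \<le> x \<Longrightarrow> p (c *\<^sub>R x) = c * p x"
    and zero: "p 0 = 0"
  shows "\<exists>C. \<forall>x\<ge>0. p x \<le> C * norm x"
proof (rule ccontr)
  assume contr: "\<nexists>C. \<forall>x\<ge>0. p x \<le> C * norm x"
  \<comment> \<open>The factor \<open>4 ^ n\<close> is \<open>2 ^ n * 2 ^ n\<close>: one half is
    spent on making the rescaled series converge, the other keeps \<open>p\<close> of its terms
    unbounded.\<close>
  have "\<exists>x\<ge>0. 4 ^ n * norm x < p x" for n :: nat
    using contr by (meson not_le)
  then obtain x where x: "\<And>n. 0 \<le> x n" "\<And>n. 4 ^ n * norm (x n) < p (x n)"
    by metis
  have pos: "0 < norm (x n)" for n using x(2)[of n] zero by auto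
  define y where "y n = inverse (2 ^ n * norm (x n)) *\<^sub>R x n" for n
  have y0: "0 \<le> y n" for n
    unfolding y_def using x(1) by (intro scaleR_nonneg_nonneg) auto
  have "norm (y n) = (1/2) ^ n" for n
    using pos[of n] by (simp add: y_def field_simps)
  then have "summable (\<lambda>n. norm (y n))" by (simp add: summable_geometric)
  then have summ: "summable y" by (rule summable_norm_cancel)
  have big: "2 ^ n < p (suminf y)" for n
  proof -
    have "p (y n) = inverse (2 ^ n * norm (x n)) * p (x n)"
      unfolding y_def using pos[of n] x(1) by (intro hom) auto
    then have "p (x n) = (2 ^ n * norm (x n)) * p (y n)"
      using pos[of n] by (simp add: field_simps)
    moreover have "(4::real) ^ n = 2 ^ n * 2 ^ n" by (simp flip: power_mult_distrib)
    ultimately have "(2 ^ n * norm (x n)) * 2 ^ n < (2 ^ n * norm (x n)) * p (y n)"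
      using x(2)[of n] by (simp add: mult_ac)
    then have "2 ^ n < p (y n)" using pos[of n] by (simp add: mult_less_cancel_left_pos)
    also have "\<dots> \<le> p (suminf y)" by (intro mono y0 le_suminf_nonneg summ)
    finally show ?thesis .
  qed
  obtain n :: nat where "p (suminf y) < 2 ^ n" using real_arch_pow[of 2] by auto
  then show False using big[of n] by simp
qed

text \<open>Turns three pointwise constructions into bounded functionals: the modulus on an ideal,
  the sum of a series and the infimum of a directed set.\<close>

lemma positive_functional_extension:
  fixes p :: "'a::banach_lattice \<Rightarrow> real"
  assumes nonneg: "\<And>x. 0 \<le> x \<Longrightarrow> 0 \<le> p x"
    and add: "\<And>x y. 0 \<le> x \<Longrightarrow> 0 \<le> y \<Longrightarrow> p (x + y) = p x + p y"
    and subhom: "\<And>c x. 0 < c \<Longrightarrow> 0 \<le> x \<Longrightarrow> p (c *\<^sub>R x) \<le> c * p x"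
  shows "\<exists>f. \<forall>x\<ge>0. blinfun_apply f x = p x"
proof -
  have mono: "p x \<le> p y" if "0 \<le> x" "x \<le> y" for x y
    using add[of x "y - x"] nonneg[of "y - x"] that by simp
  have zero: "p 0 = 0" using add[of 0 0] by simp
  have hom: "p (c *\<^sub>R x) = c * p x" if "0 < c" "0 \<le> x" for c x
  proof (rule order_antisym)
    show "p (c *\<^sub>R x) \<le> c * p x" using that by (rule subhom)
    have "p (inverse c *\<^sub>R c *\<^sub>R x) \<le> inverse c * p (c *\<^sub>R x)"
      using that by (intro subhom scaleR_nonneg_nonneg) auto
    then show "c * p x \<le> p (c *\<^sub>R x)" using that(1) by (simp add: field_simps)
  qed
  obtain C where C: "\<And>x. 0 \<le> x \<Longrightarrow> p x \<le> C * norm x"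
    using nonneg_bounded_on_cone[of p, OF mono hom zero] by auto
  define F where "F x = p (pprt x) - p (pprt (- x))" for x :: 'a
  \<comment> \<open>The value is independent of how a vector is written as a difference of positive
    vectors, so linearity can be checked on convenient representations.\<close>
  have F_diff: "F (a - b) = p a - p b" if "0 \<le> a" "0 \<le> b" for a b
  proof -
    have "pprt (a - b) + b = a + pprt (- (a - b))"
      using eq_pprt_diff_pprt[of "a - b"] by (simp add: algebra_simps)
    then have "p (pprt (a - b)) + p b = p a + p (pprt (- (a - b)))"
      using add[of "pprt (a - b)" b] add[of a "pprt (- (a - b))"] that by simp
    then show ?thesis by (simp add: F_def)
  qed
  have "bounded_linear F"
  proof (rule bounded_linear_intro)
    fix x y :: 'a
    have "x + y = (pprt x + pprt y) - (pprt (- x) + pprt (- y))"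
      using arg_cong2[OF eq_pprt_diff_pprt[of x] eq_pprt_diff_pprt[of y], of plus]
      by (simp add: algebra_simps)
    then have "F (x + y) = p (pprt x + pprt y) - p (pprt (- x) + pprt (- y))"
      using F_diff[of "pprt x + pprt y" "pprt (- x) + pprt (- y)"] by simp
    then show "F (x + y) = F x + F y" by (simp add: add F_def)
  next
    fix c :: real and x :: 'a
    consider "c = 0" | "0 < c" | "c < 0" by linarith
    then show "F (c *\<^sub>R x) = c *\<^sub>R F x"
    proof cases
      case 1
      then show ?thesis by (simp add: F_def zero)
    next
      case 2
      have "c *\<^sub>R x = c *\<^sub>R pprt x - c *\<^sub>R pprt (- x)"
        by (metis eq_pprt_diff_pprt scaleR_diff_right)
      moreover have "0 \<le> c *\<^sub>R pprt x" "0 \<le> c *\<^sub>R pprt (- x)"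
        using 2 by (auto intro!: scaleR_nonneg_nonneg)
      ultimately have "F (c *\<^sub>R x) = p (c *\<^sub>R pprt x) - p (c *\<^sub>R pprt (- x))"
        using F_diff by simp
      then show ?thesis using 2 by (simp add: hom F_def right_diff_distrib)
    next
      case 3
      have "c *\<^sub>R x = (- c) *\<^sub>R pprt (- x) - (- c) *\<^sub>R pprt x"
        using arg_cong[OF eq_pprt_diff_pprt[of x], of "scaleR c"]
        by (simp add: scaleR_diff_right)
      moreover have "0 \<le> (- c) *\<^sub>R pprt x" "0 \<le> (- c) *\<^sub>R pprt (- x)"
        using 3 by (intro scaleR_nonneg_nonneg; simp)+
      ultimately have "F (c *\<^sub>R x) = p ((- c) *\<^sub>R pprt (- x)) - p ((- c) *\<^sub>R pprt x)"
        using F_diff by metis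
      also have "\<dots> = (- c) * p (pprt (- x)) - (- c) * p (pprt x)"
        using 3 by (simp only: hom zero_le_pprt neg_0_less_iff_less)
      finally show ?thesis by (simp add: F_def right_diff_distrib)
    qed
  next
    fix x
    have "\<bar>F x\<bar> \<le> p (pprt x) + p (pprt (- x))"
      using nonneg[of "pprt x"] nonneg[of "pprt (- x)"] by (simp add: F_def)
    also have "\<dots> \<le> p \<bar>x\<bar> + p \<bar>x\<bar>"
      using pprt_le_abs[of x] pprt_le_abs[of "- x"] by (intro add_mono mono) simp_all
    also have "\<dots> \<le> C * norm x + C * norm x"
      using C[of "\<bar>x\<bar>"] by simp
    finally show "norm (F x) \<le> norm x * (2 * C)" by (simp add: algebra_simps)
  qed
  moreover have "F x = p x" if "0 \<le> x" for x using F_diff[OF that, of 0] zero by simp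
  ultimately show ?thesis by (metis bounded_linear_Blinfun_apply)
qed

section \<open>Order and norm estimates for positive functionals\<close>

lemma nonneg_blinfun_abs_le:
  fixes f :: "'a::banach_lattice \<Rightarrow>\<^sub>L real"
  assumes "0 \<le> f"
  shows "\<bar>blinfun_apply f x\<bar> \<le> blinfun_apply f \<bar>x\<bar>"
proof -
  have "0 \<le> blinfun_apply f (\<bar>x\<bar> - x)" "0 \<le> blinfun_apply f (\<bar>x\<bar> + x)"
    using assms abs_ge_self[of x] add_left_mono[OF abs_ge_minus_self[of x], of x]
    by (auto simp: less_eq_blinfun_def add.commute)
  then show ?thesis by (simp add: blinfun.diff_right blinfun.add_right)
qed

lemma nonneg_blinfun_mono:
  fixes f :: "'a::banach_lattice \<Rightarrow>\<^sub>L real"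
  assumes "0 \<le> f" "x \<le> y"
  shows "blinfun_apply f x \<le> blinfun_apply f y"
proof -
  have "0 \<le> blinfun_apply f (y - x)" using assms by (simp add: less_eq_blinfun_def)
  then show ?thesis by (simp add: blinfun.diff_right)
qed

text \<open>Replacing \<open>x\<close> by \<open>\<bar>x\<bar>\<close> keeps the norm and does not
  decrease the absolute value of a positive functional, so its norm is determined on the positive
  part of the unit ball.\<close>

lemma nonneg_blinfun_large_norm:
  fixes f :: "'a::banach_lattice \<Rightarrow>\<^sub>L real"
  assumes "0 \<le> f" "c < norm f" "0 \<le> c"
  shows "\<exists>x\<ge>0. norm x \<le> 1 \<and> c < blinfun_apply f x"
proof (rule ccontr)
  assume contr: "\<not> ?thesis"
  have "norm (blinfun_apply f x) \<le> c * norm x" for x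
  proof (cases "x = 0")
    case False
    let ?y = "inverse (norm x) *\<^sub>R \<bar>x\<bar>"
    have "0 \<le> ?y" "norm ?y \<le> 1" using False by (auto intro!: scaleR_nonneg_nonneg)
    then have "blinfun_apply f ?y \<le> c" using contr by (meson not_le)
    then have "blinfun_apply f \<bar>x\<bar> \<le> c * norm x"
      using False by (simp add: blinfun.scaleR_right field_simps)
    then show ?thesis using nonneg_blinfun_abs_le[OF assms(1), of x] by simp
  qed simp
  then have "norm f \<le> c" by (intro norm_blinfun_bound assms(3))
  then show False using assms(2) by simp
qed

lemma nonneg_blinfun_norm_mono:
  fixes f g :: "'a::banach_lattice \<Rightarrow>\<^sub>L real"
  assumes "0 \<le> f" "f \<le> g"
  shows "norm f \<le> norm g"
proof (rule norm_blinfun_bound)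
  fix x
  have "\<bar>blinfun_apply f x\<bar> \<le> blinfun_apply f \<bar>x\<bar>" using assms(1) by (rule nonneg_blinfun_abs_le)
  also have "\<dots> \<le> blinfun_apply g \<bar>x\<bar>" using assms(2) by (simp add: less_eq_blinfun_def)
  also have "\<dots> \<le> norm g * norm x" using norm_blinfun[of g "\<bar>x\<bar>"] by simp
  finally show "norm (blinfun_apply f x) \<le> norm g * norm x" by simp
qed simp

section \<open>Disjoint ideals and order continuity of the dual norm\<close>

text \<open>The piece \<open>z1\<close> is \<open>z\<close> truncated to the interval from
  \<open>- x\<close> to \<open>x\<close>. The bound
  \<open>\<bar>z1\<bar> \<le> \<bar>z\<bar>\<close> keeps both pieces in every ideal that contains
  \<open>z\<close>.\<close>

lemma riesz_decomposition:
  fixes x y z :: "'a::banach_lattice"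
  assumes "\<bar>z\<bar> \<le> x + y" "0 \<le> x" "0 \<le> y"
  obtains z1 z2 where "z = z1 + z2" "\<bar>z1\<bar> \<le> x" "\<bar>z2\<bar> \<le> y" "\<bar>z1\<bar> \<le> \<bar>z\<bar>"
proof
  define w where "w = sup (- x) (inf z x)"
  have z: "z \<le> x + y" "- z \<le> x + y" using assms(1) by (auto simp: abs_le_iff)
  show "z = w + (z - w)" by simp
  have "- x \<le> x" using assms(2) by (meson neg_le_0_iff_le order_trans)
  then have "- x \<le> w" "w \<le> x" by (auto simp: w_def)
  then show "\<bar>w\<bar> \<le> x" by (intro abs_leI) (simp_all add: minus_le_iff)
  have "w \<le> \<bar>z\<bar>" unfolding w_def
    using assms(2) by (intro le_supI le_infI1 abs_ge_self) (meson abs_ge_zero neg_le_0_iff_le order_trans)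
  moreover have "- \<bar>z\<bar> \<le> w" unfolding w_def
    using assms(2) abs_ge_minus_self[of z]
    by (intro le_supI2 le_infI) (auto simp: minus_le_iff intro: order_trans[of _ 0])
  ultimately show "\<bar>w\<bar> \<le> \<bar>z\<bar>" by (intro abs_leI) (simp_all add: minus_le_iff)
  have "z - y \<le> w" unfolding w_def
    using z assms(3) by (intro le_supI2 le_infI) (simp_all add: algebra_simps)
  moreover have "w \<le> z + y" unfolding w_def
  proof (intro le_supI le_infI1)
    have "- z + (z - x) \<le> x + y + (z - x)" using z(2) by (rule add_right_mono)
    then show "- x \<le> z + y" by (simp add: algebra_simps)
  qed (use assms(3) in simp)
  ultimately show "\<bar>z - w\<bar> \<le> y" by (intro abs_leI) (simp_all add: algebra_simps)
qed

section \<open>Principal ideals\<close>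

definition principal_ideal :: "'a::banach_lattice \<Rightarrow> 'a set" where
  "principal_ideal u = {z. \<exists>k\<ge>0. \<bar>z\<bar> \<le> k *\<^sub>R u}"

lemma principal_ideal_refl: "z \<in> principal_ideal \<bar>z\<bar>"
  unfolding principal_ideal_def by (auto intro!: exI[of _ 1])

lemma principal_ideal_0: "0 \<in> principal_ideal u"
  unfolding principal_ideal_def by (auto intro!: exI[of _ 0])

lemma principal_ideal_add:
  assumes "y \<in> principal_ideal u" "z \<in> principal_ideal u"
  shows "y + z \<in> principal_ideal u"
proof -
  obtain k l where "0 \<le> k" "0 \<le> l" "\<bar>y\<bar> \<le> k *\<^sub>R u" "\<bar>z\<bar> \<le> l *\<^sub>R u"
    using assms unfolding principal_ideal_def by auto
  then have "0 \<le> k + l" "\<bar>y + z\<bar> \<le> (k + l) *\<^sub>R u"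
    using order_trans[OF abs_triangle_ineq add_mono] by (simp_all add: scaleR_add_left)
  then show ?thesis unfolding principal_ideal_def by blast
qed

lemma principal_ideal_solid:
  "z \<in> principal_ideal u \<Longrightarrow> \<bar>y\<bar> \<le> \<bar>z\<bar> \<Longrightarrow> y \<in> principal_ideal u"
  unfolding principal_ideal_def by (blast intro: order_trans)

lemma principal_ideal_uminus: "z \<in> principal_ideal u \<Longrightarrow> - z \<in> principal_ideal u"
  by (erule principal_ideal_solid) simp

lemma principal_ideal_scaleR:
  assumes "z \<in> principal_ideal u" "0 \<le> c"
  shows "c *\<^sub>R z \<in> principal_ideal u"
proof -
  obtain k where "0 \<le> k" "\<bar>z\<bar> \<le> k *\<^sub>R u"
    using assms unfolding principal_ideal_def by auto
  then have "\<bar>c *\<^sub>R z\<bar> \<le> (c * k) *\<^sub>R u"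
    using scaleR_left_mono[of "\<bar>z\<bar>" "k *\<^sub>R u" c] assms(2) by (simp add: abs_scaleR_nonneg)
  moreover have "0 \<le> c * k" using \<open>0 \<le> k\<close> assms(2) by simp
  ultimately show ?thesis unfolding principal_ideal_def by blast
qed

lemma principal_ideal_disjoint:
  fixes u v :: "'a::banach_lattice"
  assumes "inf u v = 0" "0 \<le> u" "0 \<le> v" "y \<in> principal_ideal u" "z \<in> principal_ideal v"
  shows "inf \<bar>y\<bar> \<bar>z\<bar> = 0"
proof (rule order_antisym)
  obtain k l where "0 \<le> k" "0 \<le> l" "\<bar>y\<bar> \<le> k *\<^sub>R u" "\<bar>z\<bar> \<le> l *\<^sub>R v"
    using assms unfolding principal_ideal_def by auto
  then show "inf \<bar>y\<bar> \<bar>z\<bar> \<le> 0"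
    using inf_mono[of "\<bar>y\<bar>" "k *\<^sub>R u" "\<bar>z\<bar>" "l *\<^sub>R v"] inf_scaleR_eq_0[OF assms(1-3)] by simp
qed simp

text \<open>The functional \<open>k\<close> below is the modulus of the restriction of \<open>g\<close> to the ideal
  generated by \<open>u\<close>, extended by \<open>0\<close> on the disjoint complement of \<open>u\<close>.\<close>

lemma ideal_modulus:
  fixes g :: "'a::banach_lattice \<Rightarrow>\<^sub>L real"
  obtains k :: "'a \<Rightarrow>\<^sub>L real" where "0 \<le> k"
    and "\<And>x z. z \<in> principal_ideal u \<Longrightarrow> \<bar>z\<bar> \<le> x \<Longrightarrow> blinfun_apply g z \<le> blinfun_apply k x"
    and "\<And>x e. 0 \<le> x \<Longrightarrow> 0 < e \<Longrightarrow>
      \<exists>z\<in>principal_ideal u. \<bar>z\<bar> \<le> x \<and> blinfun_apply k x - e < blinfun_apply g z"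
proof -
  define Z where "Z x = {z \<in> principal_ideal u. \<bar>z\<bar> \<le> x}" for x
  define p where "p x = (SUP z\<in>Z x. blinfun_apply g z)" for x
  have zero: "0 \<in> Z x" if "0 \<le> x" for x
    using that by (simp add: Z_def principal_ideal_0)
  have bdd: "bdd_above (blinfun_apply g ` Z x)" for x
  proof (rule bdd_aboveI2)
    fix z assume "z \<in> Z x"
    then have "\<bar>z\<bar> \<le> \<bar>x\<bar>" by (auto simp: Z_def intro: order_trans[OF _ abs_ge_self])
    then have "norm g * norm z \<le> norm g * norm x"
      by (intro mult_left_mono norm_lattice_mono) auto
    then show "blinfun_apply g z \<le> norm g * norm x" using norm_blinfun[of g z] by simp
  qed
  have upper: "blinfun_apply g z \<le> p x" if "z \<in> Z x" for x z
    unfolding p_def using that bdd by (intro cSUP_upper)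
  have least: "p x \<le> c" if "0 \<le> x" "\<And>z. z \<in> Z x \<Longrightarrow> blinfun_apply g z \<le> c" for x c
    unfolding p_def using that zero by (intro cSUP_least) auto
  have approx: "\<exists>z\<in>Z x. p x - e < blinfun_apply g z" if "0 \<le> x" "0 < e" for x e
    using least[OF that(1), of "p x - e"] that(2) by (meson diff_less_eq less_add_same_cancel1 not_le)
  have "\<exists>k. \<forall>x\<ge>0. blinfun_apply k x = p x"
  proof (rule positive_functional_extension)
    show "0 \<le> p x" if "0 \<le> x" for x using upper[OF zero[OF that]] by simp
  next
    fix x y :: 'a assume xy: "0 \<le> x" "0 \<le> y"
    show "p (x + y) = p x + p y"
    proof (rule order_antisym)
      show "p (x + y) \<le> p x + p y"
      proof (rule least)
        fix z assume "z \<in> Z (x + y)"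
        then have z: "z \<in> principal_ideal u" "\<bar>z\<bar> \<le> x + y" by (auto simp: Z_def)
        obtain z1 z2 where d: "z = z1 + z2" "\<bar>z1\<bar> \<le> x" "\<bar>z2\<bar> \<le> y" "\<bar>z1\<bar> \<le> \<bar>z\<bar>"
          using riesz_decomposition[OF z(2) xy] .
        have z1: "z1 \<in> principal_ideal u" using z(1) d(4) by (rule principal_ideal_solid)
        have "z2 = z + - z1" using d(1) by simp
        then have "z2 \<in> principal_ideal u"
          using z(1) z1 principal_ideal_add principal_ideal_uminus by metis
        then have "blinfun_apply g z1 \<le> p x" "blinfun_apply g z2 \<le> p y"
          using z1 d by (auto intro!: upper simp: Z_def)
        then show "blinfun_apply g z \<le> p x + p y" by (simp add: d(1) blinfun.add_right)
      qed (use xy in simp)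
      show "p x + p y \<le> p (x + y)"
      proof (rule field_le_epsilon)
        fix e :: real assume "0 < e"
        obtain z1 where z1: "z1 \<in> Z x" "p x - e / 2 < blinfun_apply g z1"
          using approx[OF xy(1), of "e / 2"] \<open>0 < e\<close> by auto
        obtain z2 where z2: "z2 \<in> Z y" "p y - e / 2 < blinfun_apply g z2"
          using approx[OF xy(2), of "e / 2"] \<open>0 < e\<close> by auto
        have "z1 + z2 \<in> Z (x + y)"
          using z1(1) z2(1) by (auto simp: Z_def principal_ideal_add
              intro: order_trans[OF abs_triangle_ineq add_mono])
        then have "blinfun_apply g z1 + blinfun_apply g z2 \<le> p (x + y)"
          using upper by (metis blinfun.add_right)
        then show "p x + p y \<le> p (x + y) + e" using z1(2) z2(2) by simp
      qed
    qed
  next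
    fix c :: real and x :: 'a assume c: "0 < c" and x: "0 \<le> x"
    show "p (c *\<^sub>R x) \<le> c * p x"
    proof (rule least)
      fix z assume "z \<in> Z (c *\<^sub>R x)"
      then have "inverse c *\<^sub>R z \<in> Z x"
        using c by (auto simp: Z_def abs_scaleR_nonneg pos_divideR_le_eq
            intro!: principal_ideal_scaleR)
      then have "inverse c * blinfun_apply g z \<le> p x"
        using upper by (metis blinfun.scaleR_right real_scaleR_def)
      then show "blinfun_apply g z \<le> c * p x" using c by (simp add: field_simps)
    qed (use c x in \<open>simp add: scaleR_nonneg_nonneg\<close>)
  qed
  then obtain k where k: "\<And>x. 0 \<le> x \<Longrightarrow> blinfun_apply k x = p x" by blast
  show thesis
  proof (rule that)
    show "0 \<le> k" using upper[OF zero] k by (simp add: less_eq_blinfun_def)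
    show "blinfun_apply g z \<le> blinfun_apply k x"
      if "z \<in> principal_ideal u" "\<bar>z\<bar> \<le> x" for x z
      using that k[of x] upper[of z x] order_trans[OF abs_ge_zero that(2)] by (simp add: Z_def)
    show "\<exists>z\<in>principal_ideal u. \<bar>z\<bar> \<le> x \<and> blinfun_apply k x - e < blinfun_apply g z"
      if "0 \<le> x" "0 < e" for x e
      using approx[OF that] k[OF that(1)] by (auto simp: Z_def)
  qed
qed

section \<open>Series of positive functionals\<close>

text \<open>The remainders \<open>R N\<close> of the series decrease to \<open>0\<close> pointwise
  on the cone, hence in the order of the dual; order continuity makes their norms small, and each
  \<open>k M\<close> lies below \<open>R M\<close>.\<close>

lemma order_continuous_norm_summands_tendsto_0:
  fixes k :: "nat \<Rightarrow> 'a::banach_lattice \<Rightarrow>\<^sub>L real"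
  assumes cont: "order_continuous_norm TYPE('a \<Rightarrow>\<^sub>L real)"
    and nonneg: "\<And>n. 0 \<le> k n"
    and bounded: "\<And>x. 0 \<le> x \<Longrightarrow> \<exists>C. \<forall>N. (\<Sum>n<N. blinfun_apply (k n) x) \<le> C"
  shows "(\<lambda>n. norm (k n)) \<longlonglongrightarrow> 0"
proof -
  have nonneg_at: "0 \<le> blinfun_apply (k n) x" if "0 \<le> x" for n x
    using nonneg[of n] that by (simp add: less_eq_blinfun_def)
  have summ: "summable (\<lambda>n. blinfun_apply (k n) x)" if x: "0 \<le> x" for x
  proof -
    obtain C where "\<And>N. (\<Sum>n<N. blinfun_apply (k n) x) \<le> C" using bounded[OF x] by auto
    then show ?thesis using nonneg_at[OF x] by (intro summableI_nonneg_bounded)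
  qed
  have "\<exists>S. \<forall>x\<ge>0. blinfun_apply S x = (\<Sum>n. blinfun_apply (k n) x)"
    by (rule positive_functional_extension)
      (simp_all add: suminf_nonneg summ nonneg_at blinfun.add_right blinfun.scaleR_right
        suminf_add[symmetric] suminf_mult)
  then obtain S where S: "\<And>x. 0 \<le> x \<Longrightarrow> blinfun_apply S x = (\<Sum>n. blinfun_apply (k n) x)"
    by blast
  define R where "R N = S - (\<Sum>n<N. k n)" for N
  have R_apply: "blinfun_apply (R N) x = blinfun_apply S x - (\<Sum>n<N. blinfun_apply (k n) x)" for N x
    by (simp add: R_def blinfun.diff_left blinfun.sum_left)
  have R_nonneg: "0 \<le> R N" for N
    unfolding less_eq_blinfun_def using sum_le_suminf[OF summ] nonneg_at
    by (auto simp: R_apply S)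
  have R_anti: "R M \<le> R N" if "N \<le> M" for M N
    unfolding less_eq_blinfun_def using that nonneg_at
    by (auto simp: R_apply intro!: sum_mono2)
  have R_glb: "l \<le> 0" if "\<And>N. l \<le> R N" for l
    unfolding less_eq_blinfun_def
  proof (intro allI impI)
    fix x :: 'a assume x: "0 \<le> x"
    have "(\<lambda>N. blinfun_apply (R N) x) \<longlonglongrightarrow> blinfun_apply S x - (\<Sum>n. blinfun_apply (k n) x)"
      unfolding R_apply by (intro tendsto_diff tendsto_const summable_LIMSEQ summ x)
    then have "blinfun_apply l x \<le> blinfun_apply S x - (\<Sum>n. blinfun_apply (k n) x)"
      using that x by (intro LIMSEQ_le_const) (auto simp: less_eq_blinfun_def)
    then show "blinfun_apply l x \<le> blinfun_apply 0 x" by (simp add: S x)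
  qed
  have small: "\<exists>N. \<forall>M\<ge>N. norm (R M) < e" if "0 < e" for e
    using order_continuous_norm_net[OF cont, of UNIV "(\<le>)" R e] R_nonneg R_anti R_glb that
    by (auto intro: max.cobounded1 max.cobounded2)
  show ?thesis
  proof (rule LIMSEQ_I)
    fix e :: real assume "0 < e"
    then obtain N where N: "\<And>M. N \<le> M \<Longrightarrow> norm (R M) < e" using small by blast
    have "norm (k M) < e" if "N \<le> M" for M
    proof -
      \<comment> \<open>The difference \<open>R M - k M\<close> is the next remainder, which is
        positive.\<close>
      have "k M \<le> R M" using R_nonneg[of "Suc M"] by (simp add: R_def algebra_simps)
      then show ?thesis using nonneg_blinfun_norm_mono[OF nonneg] N[OF that] by fastforce
    qed
    then show "\<exists>N. \<forall>n\<ge>N. norm (norm (k n) - 0) < e" by auto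
  qed
qed

section \<open>Order continuity of the dual norm implies compactness\<close>

text \<open>The signed sums of the \<open>z n\<close> all lie in one order interval, whose image under \<open>T\<close> bounds
  the sum of the \<open>\<bar>T (z n)\<bar>\<close>.\<close>

lemma sum_order_bounded_le:
  fixes T :: "'e::banach_lattice \<Rightarrow>\<^sub>L 'f::banach_lattice"
  assumes T: "order_bounded_operator T" and x: "0 \<le> x"
  obtains C where "\<And>(f :: nat \<Rightarrow> 'f \<Rightarrow>\<^sub>L real) z N. range f \<subseteq> {a..b} \<Longrightarrow>
    disjoint_sequence z \<Longrightarrow> (\<And>n. \<bar>z n\<bar> \<le> x) \<Longrightarrow>
    (\<Sum>n<N. blinfun_apply (f n) (blinfun_apply T (z n))) \<le> C"
proof -
  have "order_bounded {- x..x}" unfolding order_bounded_def by blast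
  then have "order_bounded (blinfun_apply T ` {- x..x})"
    using T unfolding order_bounded_operator_def by blast
  then obtain q where q: "\<And>w. w \<in> {- x..x} \<Longrightarrow> blinfun_apply T w \<le> q"
    unfolding order_bounded_def by fastforce
  show thesis
  proof (rule that)
    fix f :: "nat \<Rightarrow> 'f \<Rightarrow>\<^sub>L real" and z :: "nat \<Rightarrow> 'e" and N :: nat
    assume f: "range f \<subseteq> {a..b}" and disj: "disjoint_sequence z" and z: "\<And>n. \<bar>z n\<bar> \<le> x"
    have f: "a \<le> f n" "f n \<le> b" for n
      using f by (auto simp: image_subset_iff)
    have sum_z: "(\<Sum>n<N. \<bar>z n\<bar>) \<le> x"
      using disj z x by (intro sum_disjoint_le) (auto simp: disjoint_sequence_def)
    have signed: "\<bar>\<Sum>n<N. s n *\<^sub>R z n\<bar> \<le> x" if s: "\<And>n. s n \<in> {-1, 1}" for s :: "nat \<Rightarrow> real"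
    proof -
      have "\<bar>\<Sum>n<N. s n *\<^sub>R z n\<bar> \<le> (\<Sum>n<N. \<bar>s n *\<^sub>R z n\<bar>)" by (rule sum_abs)
      also have "\<dots> = (\<Sum>n<N. \<bar>z n\<bar>)"
        using s by (intro sum.cong refl) (metis abs_minus_cancel empty_iff insert_iff scaleR_minus1_left scaleR_one)
      finally show ?thesis using sum_z by simp
    qed
    have sum_T: "(\<Sum>n<N. \<bar>blinfun_apply T (z n)\<bar>) \<le> q"
    proof (rule sum_abs_le_of_signed_sums)
      fix s :: "nat \<Rightarrow> real" assume "\<And>n. s n \<in> {-1, 1}"
      then have "(\<Sum>n<N. s n *\<^sub>R z n) \<in> {- x..x}"
        using signed[of s] by (simp add: abs_le_iff minus_le_iff)
      then have "blinfun_apply T (\<Sum>n<N. s n *\<^sub>R z n) \<le> q" by (rule q)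
      then show "(\<Sum>n<N. s n *\<^sub>R blinfun_apply T (z n)) \<le> q"
        by (simp add: blinfun.sum_right blinfun.scaleR_right)
    qed simp
    have ba: "0 \<le> b - a" using f[of 0] by (simp add: order_trans[of a "f 0" b])
    \<comment> \<open>Each \<open>f n\<close> is \<open>a\<close> plus a positive functional below
      \<open>b - a\<close>. The part \<open>a\<close> does not depend on \<open>n\<close> and acts
      on the plain sum of the \<open>z n\<close>; the remainder is controlled by the sum of the
      moduli.\<close>
    have split: "blinfun_apply (f n) y \<le> blinfun_apply a y + blinfun_apply (b - a) \<bar>y\<bar>" for n y
    proof -
      have "blinfun_apply (f n - a) y \<le> blinfun_apply (f n - a) \<bar>y\<bar>"
        using f by (intro nonneg_blinfun_mono abs_ge_self) simp
      also have "\<dots> \<le> blinfun_apply (b - a) \<bar>y\<bar>"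
        using f(2)[of n] by (simp add: less_eq_blinfun_def blinfun.diff_left)
      finally show ?thesis by (simp add: blinfun.diff_left)
    qed
    have "(\<Sum>n<N. blinfun_apply (f n) (blinfun_apply T (z n))) \<le>
        (\<Sum>n<N. blinfun_apply a (blinfun_apply T (z n))
          + blinfun_apply (b - a) \<bar>blinfun_apply T (z n)\<bar>)"
      by (intro sum_mono split)
    also have "\<dots> = blinfun_apply a (blinfun_apply T (\<Sum>n<N. z n))
        + blinfun_apply (b - a) (\<Sum>n<N. \<bar>blinfun_apply T (z n)\<bar>)"
      by (simp add: sum.distrib blinfun.sum_right)
    also have "\<dots> \<le> norm a * (norm T * norm x) + blinfun_apply (b - a) q"
    proof (intro add_mono nonneg_blinfun_mono ba sum_T)
      have "norm (\<Sum>n<N. z n) \<le> norm x"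
        using signed[of "\<lambda>_. 1"] x by (intro norm_lattice_mono) simp
      then have "norm T * norm (\<Sum>n<N. z n) \<le> norm T * norm x" by (intro mult_left_mono) auto
      then have "norm (blinfun_apply T (\<Sum>n<N. z n)) \<le> norm T * norm x"
        using norm_blinfun order_trans by blast
      then have "norm a * norm (blinfun_apply T (\<Sum>n<N. z n)) \<le> norm a * (norm T * norm x)"
        by (intro mult_left_mono) auto
      then have "norm (blinfun_apply a (blinfun_apply T (\<Sum>n<N. z n))) \<le> norm a * (norm T * norm x)"
        using norm_blinfun order_trans by blast
      then show "blinfun_apply a (blinfun_apply T (\<Sum>n<N. z n)) \<le> norm a * (norm T * norm x)"
        by simp
    qed
    finally show "(\<Sum>n<N. blinfun_apply (f n) (blinfun_apply T (z n))) \<le>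
        norm a * (norm T * norm x) + blinfun_apply (b - a) q" .
  qed
qed

lemma order_M_weakly_compact_if_order_continuous_dual:
  fixes T :: "'e::banach_lattice \<Rightarrow>\<^sub>L 'f::banach_lattice"
  assumes cont: "order_continuous_norm TYPE('e \<Rightarrow>\<^sub>L real)" and T: "order_bounded_operator T"
  shows "order_M_weakly_compact T"
  unfolding order_M_weakly_compact_def
proof (intro allI impI, elim conjE)
  fix x :: "nat \<Rightarrow> 'e" and f :: "nat \<Rightarrow> 'f \<Rightarrow>\<^sub>L real"
  assume disj: "disjoint_sequence x" and ball: "range x \<subseteq> cball 0 1"
    and "order_bounded (range f)"
  then obtain a b where f: "range f \<subseteq> {a..b}" unfolding order_bounded_def by blast
  let ?I = "\<lambda>n. principal_ideal \<bar>x n\<bar>"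
  define g where "g n = f n o\<^sub>L T" for n
  have "\<exists>k. 0 \<le> k \<and>
      (\<forall>w z. z \<in> ?I n \<longrightarrow> \<bar>z\<bar> \<le> w \<longrightarrow> blinfun_apply (g n) z \<le> blinfun_apply k w) \<and>
      (\<forall>w e. 0 \<le> w \<longrightarrow> 0 < e \<longrightarrow>
        (\<exists>z\<in>?I n. \<bar>z\<bar> \<le> w \<and> blinfun_apply k w - e < blinfun_apply (g n) z))" for n
    using ideal_modulus[of "\<bar>x n\<bar>" "g n"] by metis
  then obtain k where k: "\<And>n. 0 \<le> k n"
    and k_upper: "\<And>n w z. z \<in> ?I n \<Longrightarrow> \<bar>z\<bar> \<le> w \<Longrightarrow> blinfun_apply (g n) z \<le> blinfun_apply (k n) w"
    and k_approx: "\<And>n w e. 0 \<le> w \<Longrightarrow> 0 < e \<Longrightarrow>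
      \<exists>z\<in>?I n. \<bar>z\<bar> \<le> w \<and> blinfun_apply (k n) w - e < blinfun_apply (g n) z"
    by metis
  have "(\<lambda>n. norm (k n)) \<longlonglongrightarrow> 0"
  proof (rule order_continuous_norm_summands_tendsto_0[OF cont k])
    fix w :: 'e assume w: "0 \<le> w"
    obtain C where C: "\<And>(f :: nat \<Rightarrow> 'f \<Rightarrow>\<^sub>L real) z N. range f \<subseteq> {a..b} \<Longrightarrow>
        disjoint_sequence z \<Longrightarrow> (\<And>n. \<bar>z n\<bar> \<le> w) \<Longrightarrow>
        (\<Sum>n<N. blinfun_apply (f n) (blinfun_apply T (z n))) \<le> C"
      using sum_order_bounded_le[OF T w] by blast
    have "(\<Sum>n<N. blinfun_apply (k n) w) \<le> C" for N
    proof (rule field_le_epsilon)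
      fix e :: real assume e: "0 < e"
      \<comment> \<open>The error allowed to each of the \<open>N\<close> summands; the added
        \<open>1\<close> avoids division by zero for \<open>N = 0\<close>.\<close>
      let ?d = "e / (real N + 1)"
      have d: "0 < ?d" using e by simp
      obtain z where z: "\<And>n. z n \<in> ?I n" "\<And>n. \<bar>z n\<bar> \<le> w"
        "\<And>n. blinfun_apply (k n) w - ?d < blinfun_apply (g n) (z n)"
        using k_approx[OF w d] by metis
      \<comment> \<open>The \<open>z n\<close> lie in ideals generated by pairwise disjoint
        elements, so the bound \<open>C\<close> applies to them.\<close>
      have "disjoint_sequence z"
        using disj z(1) principal_ideal_disjoint[OF _ abs_ge_zero abs_ge_zero]
        unfolding disjoint_sequence_def by blast
      then have C': "(\<Sum>n<N. blinfun_apply (g n) (z n)) \<le> C"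
        using C[OF f _ z(2), where N=N] by (simp add: g_def)
      have "(\<Sum>n<N. blinfun_apply (k n) w) \<le> (\<Sum>n<N. blinfun_apply (g n) (z n) + ?d)"
        using z(3) by (intro sum_mono) (simp add: diff_less_eq less_imp_le)
      also have "\<dots> \<le> C + N * ?d" using C' by (simp add: sum.distrib)
      also have "N * ?d \<le> e" using e by (simp add: field_simps)
      finally show "(\<Sum>n<N. blinfun_apply (k n) w) \<le> C + e" by simp
    qed
    then show "\<exists>C. \<forall>N. (\<Sum>n<N. blinfun_apply (k n) w) \<le> C" by blast
  qed
  \<comment> \<open>Both \<open>x n\<close> and \<open>- x n\<close> belong to the ideal, so the
    one-sided bound by \<open>k n\<close> controls the absolute value.\<close>
  moreover have "norm (blinfun_apply (g n) (x n)) \<le> norm (k n)" for n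
  proof -
    have "blinfun_apply (g n) (x n) \<le> blinfun_apply (k n) \<bar>x n\<bar>"
      by (intro k_upper principal_ideal_refl order_refl)
    moreover have "blinfun_apply (g n) (- x n) \<le> blinfun_apply (k n) \<bar>x n\<bar>"
      by (intro k_upper principal_ideal_uminus principal_ideal_refl) simp
    moreover have "blinfun_apply (k n) \<bar>x n\<bar> \<le> norm (k n) * norm (x n)"
      using norm_blinfun[of "k n" "\<bar>x n\<bar>"] by simp
    moreover have "norm (k n) * norm (x n) \<le> norm (k n)"
      using ball by (intro mult_left_le) (auto simp: image_subset_iff)
    ultimately show ?thesis by (simp add: blinfun.minus_right abs_le_iff)
  qed
  ultimately have "(\<lambda>n. blinfun_apply (g n) (x n)) \<longlonglongrightarrow> 0"
    using Lim_null_comparison[of "\<lambda>n. blinfun_apply (g n) (x n)" "\<lambda>n. norm (k n)" sequentially]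
    by simp
  then show "(\<lambda>n. blinfun_apply (f n) (blinfun_apply T (x n))) \<longlonglongrightarrow> 0"
    by (simp add: g_def)
qed

section \<open>Disjointification\<close>

lemma pprt_disjoint: "inf (pprt w) (pprt (- w)) = (0::'a::lattice_ab_group_add)"
proof -
  have "pprt w = w + pprt (- w)" using prts[of w] by (simp add: pprt_neg algebra_simps)
  then have "inf (pprt w) (pprt (- w)) = inf (w + pprt (- w)) (0 + pprt (- w))" by simp
  also have "\<dots> = nprt w + pprt (- w)" by (simp only: add_inf_distrib_right nprt_def)
  finally show ?thesis by (simp add: pprt_neg)
qed

text \<open>Let \<open>u n\<close> be the terms of the new sequence, \<open>m < n\<close> and
  \<open>w = x m - (1/4) ^ n *\<^sub>R x n\<close>. The subtracted \<open>X\<close> gives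
  \<open>u m \<le> pprt w\<close>, the subtracted sum, which contains \<open>x m\<close>, gives
  \<open>u n \<le> 4 ^ n *\<^sub>R pprt (- w)\<close>, and the two parts of \<open>w\<close> are
  disjoint.\<close>

lemma disjointification:
  fixes x :: "nat \<Rightarrow> 'a::banach_lattice"
  assumes nonneg: "\<And>n. 0 \<le> x n" and ball: "\<And>n. norm (x n) \<le> 1"
  obtains X where "disjoint_sequence
      (\<lambda>n. pprt (x n - 4 ^ n *\<^sub>R (\<Sum>i<n. x i) - (1/2) ^ n *\<^sub>R X))" and "0 \<le> X"
proof -
  define X where "X = (\<Sum>n. (1/2) ^ n *\<^sub>R x n)"
  define u where "u n = pprt (x n - 4 ^ n *\<^sub>R (\<Sum>i<n. x i) - (1/2) ^ n *\<^sub>R X)" for n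
  have term_nonneg: "0 \<le> (1/2) ^ n *\<^sub>R x n" for n :: nat
    using nonneg by (intro scaleR_nonneg_nonneg) auto
  have "summable (\<lambda>n. norm ((1/2) ^ n *\<^sub>R x n))"
  proof (rule summable_comparison_test')
    show "summable (\<lambda>n. (1/2::real) ^ n)" by (simp add: summable_geometric)
    show "norm (norm ((1/2) ^ n *\<^sub>R x n)) \<le> (1/2) ^ n" if "0 \<le> n" for n
      using ball[of n] by (simp add: mult_left_le)
  qed
  then have "summable (\<lambda>n. (1/2) ^ n *\<^sub>R x n)" by (rule summable_norm_cancel)
  then have X: "(1/2) ^ n *\<^sub>R x n \<le> X" for n
    unfolding X_def by (rule le_suminf_nonneg[OF _ term_nonneg])
  have X0: "0 \<le> X" using term_nonneg[of 0] X[of 0] by (rule order_trans)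
  have disj: "inf (u m) (u n) = 0" if "m < n" for m n
  proof (rule order_antisym)
    let ?w = "x m - (1/4) ^ n *\<^sub>R x n"
    \<comment> \<open>Here \<open>(1/2) ^ m\<close> is the coefficient of \<open>X\<close> in
      \<open>u m\<close> and \<open>(1/2) ^ n\<close> that of \<open>x n\<close> in
      \<open>X\<close>.\<close>
    have "(1/2) ^ m * (1/2) ^ n \<ge> (1/4::real) ^ n"
    proof -
      have "(1/4::real) ^ n = (1/2) ^ n * (1/2) ^ n" by (simp flip: power_mult_distrib)
      also have "\<dots> \<le> (1/2) ^ m * (1/2) ^ n"
        using that by (intro mult_right_mono power_decreasing) auto
      finally show ?thesis .
    qed
    then have "(1/4) ^ n *\<^sub>R x n \<le> ((1/2) ^ m * (1/2) ^ n) *\<^sub>R x n"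
      using nonneg by (intro scaleR_right_mono)
    also have "\<dots> \<le> (1/2) ^ m *\<^sub>R X"
      using scaleR_left_mono[OF X[of n], of "(1/2) ^ m"] by simp
    finally have "(1/4) ^ n *\<^sub>R x n \<le> (1/2) ^ m *\<^sub>R X" .
    moreover have "0 \<le> 4 ^ m *\<^sub>R (\<Sum>i<m. x i)"
      using nonneg by (intro scaleR_nonneg_nonneg sum_nonneg) auto
    ultimately have "x m - 4 ^ m *\<^sub>R (\<Sum>i<m. x i) - (1/2) ^ m *\<^sub>R X \<le> x m - 0 - (1/4) ^ n *\<^sub>R x n"
      by (intro diff_mono) auto
    then have um: "u m \<le> pprt ?w" unfolding u_def by (intro pprt_mono) simp
    have "(\<Sum>i<n. x i) = x m + sum x ({..<n} - {m})"
      using that by (intro sum.remove) auto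
    then have "x m \<le> (\<Sum>i<n. x i)" using nonneg by (simp add: sum_nonneg)
    then have "4 ^ n *\<^sub>R x m \<le> 4 ^ n *\<^sub>R (\<Sum>i<n. x i)" by (intro scaleR_left_mono) auto
    moreover have "0 \<le> (1/2) ^ n *\<^sub>R X" using X0 by (intro scaleR_nonneg_nonneg) auto
    ultimately have "x n - 4 ^ n *\<^sub>R (\<Sum>i<n. x i) - (1/2) ^ n *\<^sub>R X \<le> x n - 4 ^ n *\<^sub>R x m - 0"
      by (intro diff_mono) auto
    also have "\<dots> = 4 ^ n *\<^sub>R (- ?w)"
      by (simp add: scaleR_diff_right power_divide)
    also have "\<dots> \<le> 4 ^ n *\<^sub>R pprt (- ?w)"
      by (intro scaleR_left_mono) (simp_all add: pprt_def)
    finally have un: "u n \<le> 4 ^ n *\<^sub>R pprt (- ?w)"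
      unfolding u_def pprt_def[of "_ - _ - _"]
      by (intro le_supI scaleR_nonneg_nonneg) (simp_all only: zero_le_pprt, auto)
    have "inf (1 *\<^sub>R pprt ?w) (4 ^ n *\<^sub>R pprt (- ?w)) = 0"
      by (intro inf_scaleR_eq_0 pprt_disjoint) auto
    then show "inf (u m) (u n) \<le> 0" using inf_mono[OF um un] by simp
  qed (simp add: u_def)
  have "disjoint_sequence u"
    unfolding disjoint_sequence_def
  proof (intro allI impI)
    fix m n :: nat assume "m \<noteq> n"
    then show "inf \<bar>u m\<bar> \<bar>u n\<bar> = 0"
      using disj[of m n] disj[of n m] by (auto simp: u_def inf_commute neq_iff)
  qed
  then show thesis using that X0 unfolding u_def by blast
qed

section \<open>Null disjoint sequences imply order continuity of the dual norm\<close>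

text \<open>Directedness makes the pointwise infimum additive on the cone, since two nearly minimal
  functionals have a common lower bound in \<open>D\<close>. The infimum thus extends to a
  functional below \<open>D\<close>, which \<open>glb\<close> forces to be at most
  \<open>0\<close>.\<close>

lemma directed_dual_infimum:
  fixes D :: "('a::banach_lattice \<Rightarrow>\<^sub>L real) set"
  assumes "D \<noteq> {}" and directed: "\<And>f g. f \<in> D \<Longrightarrow> g \<in> D \<Longrightarrow> \<exists>h\<in>D. h \<le> f \<and> h \<le> g"
    and nonneg: "\<And>f. f \<in> D \<Longrightarrow> 0 \<le> f" and glb: "\<And>l. (\<And>f. f \<in> D \<Longrightarrow> l \<le> f) \<Longrightarrow> l \<le> 0"
    and x: "0 \<le> x" and e: "0 < e"
  shows "\<exists>f\<in>D. blinfun_apply f x < e"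
proof -
  define p where "p x = (INF f\<in>D. blinfun_apply f x)" for x
  have nonneg_at: "0 \<le> blinfun_apply f x" if "f \<in> D" "0 \<le> x" for f x
    using nonneg that by (auto simp: less_eq_blinfun_def)
  have lower: "p x \<le> blinfun_apply f x" if "f \<in> D" "0 \<le> x" for f x
    unfolding p_def using nonneg_at that by (intro cINF_lower bdd_belowI2[of _ 0]) auto
  have greatest: "c \<le> p x" if "\<And>f. f \<in> D \<Longrightarrow> c \<le> blinfun_apply f x" for c x
    unfolding p_def using assms(1) that by (rule cINF_greatest)
  have approx: "\<exists>f\<in>D. blinfun_apply f x < p x + e" if "0 < e" for e x
    using greatest[of "p x + e" x] that by (meson add_le_same_cancel1 not_le)
  have "\<exists>l. \<forall>x\<ge>0. blinfun_apply l x = p x"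
  proof (rule positive_functional_extension)
    show "0 \<le> p x" if "0 \<le> x" for x using nonneg_at that by (intro greatest)
  next
    fix x y :: 'a assume xy: "0 \<le> x" "0 \<le> y"
    show "p (x + y) = p x + p y"
    proof (rule order_antisym)
      show "p x + p y \<le> p (x + y)"
        using lower xy by (intro greatest) (simp add: blinfun.add_right add_mono)
      show "p (x + y) \<le> p x + p y"
      proof (rule field_le_epsilon)
        fix e :: real assume "0 < e"
        then obtain f g where fg: "f \<in> D" "blinfun_apply f x < p x + e / 2"
          "g \<in> D" "blinfun_apply g y < p y + e / 2"
          using approx[of "e / 2" x] approx[of "e / 2" y] by auto
        obtain h where h: "h \<in> D" "h \<le> f" "h \<le> g" using directed fg by blast
        have "p (x + y) \<le> blinfun_apply h x + blinfun_apply h y"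
          using lower[OF h(1), of "x + y"] xy by (simp add: blinfun.add_right)
        also have "\<dots> \<le> blinfun_apply f x + blinfun_apply g y"
          using h xy by (intro add_mono) (auto simp: less_eq_blinfun_def)
        finally show "p (x + y) \<le> p x + p y + e" using fg by simp
      qed
    qed
  next
    fix c :: real and x :: 'a assume c: "0 < c" and x: "0 \<le> x"
    have "p (c *\<^sub>R x) / c \<le> p x"
    proof (rule greatest)
      fix f assume "f \<in> D"
      then have "p (c *\<^sub>R x) \<le> c * blinfun_apply f x"
        using lower[of f "c *\<^sub>R x"] c x by (simp add: blinfun.scaleR_right scaleR_nonneg_nonneg)
      then show "p (c *\<^sub>R x) / c \<le> blinfun_apply f x" using c by (simp add: field_simps)
    qed
    then show "p (c *\<^sub>R x) \<le> c * p x" using c by (simp add: field_simps)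
  qed
  then obtain l where l: "\<And>x. 0 \<le> x \<Longrightarrow> blinfun_apply l x = p x" by blast
  have "l \<le> 0" using lower l by (intro glb) (simp add: less_eq_blinfun_def)
  then have "p x \<le> 0" using l[OF x] x by (auto simp: less_eq_blinfun_def)
  then show ?thesis using approx[OF e, of x] by force
qed

lemma order_continuous_dual_if_disjoint_weakly_null:
  assumes null: "\<And>(f :: 'a::banach_lattice \<Rightarrow>\<^sub>L real) x.
    disjoint_sequence x \<Longrightarrow> range x \<subseteq> cball 0 1 \<Longrightarrow> (\<lambda>n. blinfun_apply f (x n)) \<longlonglongrightarrow> 0"
  shows "order_continuous_norm TYPE('a \<Rightarrow>\<^sub>L real)"
  unfolding order_continuous_norm_def
proof (intro allI impI, elim conjE, rule ccontr)
  fix D :: "('a \<Rightarrow>\<^sub>L real) set" and e :: real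
  assume ne: "D \<noteq> {}" and directed: "\<forall>x\<in>D. \<forall>y\<in>D. \<exists>z\<in>D. z \<le> x \<and> z \<le> y"
    and nonneg: "\<forall>x\<in>D. 0 \<le> x" and glb: "\<forall>l. (\<forall>x\<in>D. l \<le> x) \<longrightarrow> l \<le> 0"
    and e: "0 < e" and contr: "\<not> (\<exists>d\<in>D. \<forall>x\<in>D. x \<le> d \<longrightarrow> norm x < e)"
  \<comment> \<open>The negated conclusion at \<open>d\<close> gives a smaller member of norm at
    least \<open>e\<close>, so \<open>d\<close> itself has norm at least \<open>e\<close>; halving
    makes the inequality strict.\<close>
  have large: "\<exists>x\<ge>0. norm x \<le> 1 \<and> e / 2 < blinfun_apply d x" if d: "d \<in> D" for d
  proof (rule nonneg_blinfun_large_norm)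
    obtain d' where "d' \<in> D" "d' \<le> d" "e \<le> norm d'" using contr d by (meson not_le)
    moreover have "norm d' \<le> norm d"
      using nonneg \<open>d' \<in> D\<close> \<open>d' \<le> d\<close> by (intro nonneg_blinfun_norm_mono) auto
    ultimately have "e \<le> norm d" by simp
    then show "e / 2 < norm d" using e by simp
    show "0 \<le> d" using nonneg d by blast
    show "0 \<le> e / 2" using e by simp
  qed
  have small: "\<exists>d'\<in>D. d' \<le> d \<and> blinfun_apply d' s < c" if "d \<in> D" "0 \<le> s" "0 < c" for d s c
  proof -
    have "\<exists>f\<in>D. blinfun_apply f s < c"
    proof (rule directed_dual_infimum[OF ne])
      show "\<exists>h\<in>D. h \<le> f \<and> h \<le> g" if "f \<in> D" "g \<in> D" for f g using directed that by blast
      show "0 \<le> f" if "f \<in> D" for f using nonneg that by blast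
      show "l \<le> 0" if "\<And>f. f \<in> D \<Longrightarrow> l \<le> f" for l using glb that by blast
    qed (fact that)+
    then obtain f where f: "f \<in> D" "blinfun_apply f s < c" by blast
    obtain d' where d': "d' \<in> D" "d' \<le> d" "d' \<le> f"
      using directed \<open>d \<in> D\<close> f(1) by blast
    then have "blinfun_apply d' s \<le> blinfun_apply f s"
      using \<open>0 \<le> s\<close> by (simp add: less_eq_blinfun_def)
    then show ?thesis using f(2) d' by (intro bexI[of _ d']) auto
  qed
  \<comment> \<open>The state holds a functional, the newest vector and the running sum
    \<open>s\<close>, which includes that vector; the clause for \<open>n = 0\<close> starts the sum
    at \<open>x 0\<close>.\<close>
  let ?P = "\<lambda>n (d, x, s). d \<in> D \<and> 0 \<le> x \<and> norm x \<le> 1 \<and> e / 2 < blinfun_apply d x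
    \<and> 0 \<le> s \<and> (n = (0::nat) \<longrightarrow> s = x)"
  \<comment> \<open>The next functional is small on the sum so far even after multiplication by
    \<open>4 ^ Suc n\<close>, the coefficient which that sum receives in the disjoint
    sequence.\<close>
  let ?Q = "\<lambda>n (d, x, s) (d', x', s'). d' \<le> d \<and> s' = s + x'
    \<and> 4 ^ Suc n * blinfun_apply d' s < e / 8"
  have "\<exists>F. \<forall>n. ?P n (F n) \<and> ?Q n (F n) (F (Suc n))"
  proof (rule dependent_nat_choice[where P = ?P and Q = ?Q])
    obtain d where d: "d \<in> D" using ne by blast
    obtain x where "0 \<le> x" "norm x \<le> 1" "e / 2 < blinfun_apply d x" using large[OF d] by blast
    then show "\<exists>t. ?P 0 t" using d by (intro exI[of _ "(d, x, x)"]) simp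
  next
    fix t n assume t: "?P n t"
    obtain d x s where dxs: "t = (d, x, s)" by (cases t)
    with t have ds: "d \<in> D" "0 \<le> s" by auto
    obtain d' where d': "d' \<in> D" "d' \<le> d" "blinfun_apply d' s < e / 8 / 4 ^ Suc n"
      using small[OF ds, of "e / 8 / 4 ^ Suc n"] e by auto
    obtain x' where "0 \<le> x'" "norm x' \<le> 1" "e / 2 < blinfun_apply d' x'"
      using large[OF d'(1)] by blast
    then show "\<exists>t'. ?P (Suc n) t' \<and> ?Q n t t'"
      using d' ds by (intro exI[of _ "(d', x', s + x')"]) (simp add: dxs field_simps)
  qed
  then obtain F where F: "\<forall>n. ?P n (F n) \<and> ?Q n (F n) (F (Suc n))" by (rule exE)
  define d where "d n = fst (F n)" for n
  define x where "x n = fst (snd (F n))" for n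
  define s where "s n = snd (snd (F n))" for n
  have F_eq: "F n = (d n, x n, s n)" for n by (simp add: d_def x_def s_def)
  have d: "d n \<in> D" and x: "0 \<le> x n" "norm (x n) \<le> 1" and dx: "e / 2 < blinfun_apply (d n) (x n)"
    and s0: "s 0 = x 0" for n
    using spec[OF F, of n] spec[OF F, of 0] by (simp_all add: F_eq)
  have d_anti: "d (Suc n) \<le> d n" and s_Suc: "s (Suc n) = s n + x (Suc n)"
    and ds: "4 ^ Suc n * blinfun_apply (d (Suc n)) (s n) < e / 8" for n
    using spec[OF F, of n] by (simp_all add: F_eq)
  have s: "s n = (\<Sum>i<Suc n. x i)" for n
    by (induction n) (simp_all add: s0 s_Suc)
  have d_le: "d n \<le> d 0" for n using lift_Suc_antimono_le[of d 0 n] d_anti by simp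
  have d_nonneg: "0 \<le> d n" for n using d nonneg by blast
  have d_sum: "4 ^ n * blinfun_apply (d n) (\<Sum>i<n. x i) \<le> e / 8" for n
  proof (cases n)
    case 0
    then show ?thesis using e by simp
  next
    case (Suc m)
    then show ?thesis using ds[of m] s[of m] by simp
  qed
  obtain X where X: "0 \<le> X" and disj: "disjoint_sequence
      (\<lambda>n. pprt (x n - 4 ^ n *\<^sub>R (\<Sum>i<n. x i) - (1/2) ^ n *\<^sub>R X))"
    using disjointification[OF x] .
  define u where "u n = pprt (x n - 4 ^ n *\<^sub>R (\<Sum>i<n. x i) - (1/2) ^ n *\<^sub>R X)" for n
  have "norm (u n) \<le> 1" for n
  proof -
    have "0 \<le> 4 ^ n *\<^sub>R (\<Sum>i<n. x i)" "0 \<le> (1/2) ^ n *\<^sub>R X"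
      using X x(1) by (auto intro!: scaleR_nonneg_nonneg sum_nonneg)
    then have "x n - 4 ^ n *\<^sub>R (\<Sum>i<n. x i) - (1/2) ^ n *\<^sub>R X \<le> x n - 0 - 0"
      by (intro diff_mono order_refl)
    then have "u n \<le> x n" unfolding u_def pprt_def[of "_ - _ - _"] using x(1) by simp
    then have "norm (u n) \<le> norm (x n)" by (intro norm_mono_nonneg) (simp_all add: u_def)
    then show ?thesis using x(2)[of n] by simp
  qed
  then have "(\<lambda>n. blinfun_apply (d 0) (u n)) \<longlonglongrightarrow> 0"
    using disj by (intro null) (auto simp: u_def)
  moreover have "(\<lambda>n. (1/2) ^ n * blinfun_apply (d 0) X) \<longlonglongrightarrow> 0"
    by (intro tendsto_mult_left_zero LIMSEQ_power_zero) simp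
  ultimately have "(\<lambda>n. blinfun_apply (d 0) (u n) + (1/2) ^ n * blinfun_apply (d 0) X) \<longlonglongrightarrow> 0 + 0"
    by (rule tendsto_add)
  \<comment> \<open>The constant is \<open>e / 2 - e / 8\<close>: the value of \<open>d n\<close> at
    \<open>x n\<close> less its value on the subtracted sum. Since \<open>u n\<close> is positive,
    \<open>d n\<close> can be replaced by the fixed \<open>d 0\<close>; the term with
    \<open>X\<close> is moved to the right, where it vanishes in the limit.\<close>
  moreover have "3 * e / 8 \<le> blinfun_apply (d 0) (u n) + (1/2) ^ n * blinfun_apply (d 0) X" for n
  proof -
    have "x n - 4 ^ n *\<^sub>R (\<Sum>i<n. x i) - (1/2) ^ n *\<^sub>R X \<le> u n" by (simp add: u_def pprt_def)
    then have "blinfun_apply (d n) (x n - 4 ^ n *\<^sub>R (\<Sum>i<n. x i) - (1/2) ^ n *\<^sub>R X)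
        \<le> blinfun_apply (d n) (u n)"
      by (intro nonneg_blinfun_mono d_nonneg)
    also have "\<dots> \<le> blinfun_apply (d 0) (u n)"
      using d_le[of n] by (simp add: less_eq_blinfun_def u_def)
    finally have "blinfun_apply (d n) (x n) - 4 ^ n * blinfun_apply (d n) (\<Sum>i<n. x i)
        - (1/2) ^ n * blinfun_apply (d n) X \<le> blinfun_apply (d 0) (u n)"
      by (simp only: blinfun.diff_right blinfun.scaleR_right real_scaleR_def)
    moreover have "(1/2) ^ n * blinfun_apply (d n) X \<le> (1/2) ^ n * blinfun_apply (d 0) X"
      using d_le[of n] X by (intro mult_left_mono) (simp_all add: less_eq_blinfun_def)
    ultimately show ?thesis using dx[of n] d_sum[of n] by linarith
  qed
  ultimately have "3 * e / 8 \<le> 0 + 0" by (intro LIMSEQ_le_const) blast+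
  then show False using e by simp
qed

section \<open>Rank one operators and the equivalence\<close>

text \<open>Order intervals are norm bounded, because \<open>0 \<le> z - a \<le> b - a\<close> for
  \<open>z\<close> between \<open>a\<close> and \<open>b\<close>. Hence \<open>f\<close> takes
  bounded values there, and multiples of the positive \<open>y\<close> by bounded scalars lie in an
  order interval.\<close>

lemma order_bounded_operator_rank_one:
  fixes f :: "'e::banach_lattice \<Rightarrow>\<^sub>L real" and y :: "'f::banach_lattice"
  assumes y: "0 \<le> y"
  shows "order_bounded_operator (blinfun_scaleR_left y o\<^sub>L f)"
  unfolding order_bounded_operator_def
proof (intro allI impI)
  fix A :: "'e set" assume "order_bounded A"
  then obtain a b where A: "A \<subseteq> {a..b}" unfolding order_bounded_def by blast
  let ?c = "norm f * (norm a + norm (b - a))"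
  have "blinfun_apply (blinfun_scaleR_left y o\<^sub>L f) ` A \<subseteq> {- ?c *\<^sub>R y..?c *\<^sub>R y}"
  proof (rule image_subsetI)
    fix z assume "z \<in> A"
    then have "norm (z - a) \<le> norm (b - a)" using A by (intro norm_mono_nonneg) auto
    then have "norm z \<le> norm a + norm (b - a)" using norm_triangle_sub[of z a] by simp
    then have "norm f * norm z \<le> ?c" by (intro mult_left_mono) auto
    then have "\<bar>blinfun_apply f z\<bar> \<le> ?c" using norm_blinfun[of f z] by simp
    then have "- ?c \<le> blinfun_apply f z" "blinfun_apply f z \<le> ?c" by linarith+
    then have "- ?c *\<^sub>R y \<le> blinfun_apply f z *\<^sub>R y" "blinfun_apply f z *\<^sub>R y \<le> ?c *\<^sub>R y"
      using scaleR_right_mono[OF _ y] by blast+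
    then show "blinfun_apply (blinfun_scaleR_left y o\<^sub>L f) z \<in> {- ?c *\<^sub>R y..?c *\<^sub>R y}" by simp
  qed
  then show "order_bounded (blinfun_apply (blinfun_scaleR_left y o\<^sub>L f) ` A)"
    unfolding order_bounded_def by blast
qed

theorem theorem2p5:
  assumes E_nonzero: "\<exists>x::'e::banach_lattice. x \<noteq> 0"
    and F_nonzero: "\<exists>y::'f::banach_lattice. y \<noteq> 0"
  shows "(\<forall>T :: 'e \<Rightarrow>\<^sub>L 'f. order_bounded_operator T \<longrightarrow> order_M_weakly_compact T) \<longleftrightarrow>
         order_continuous_norm TYPE('e \<Rightarrow>\<^sub>L real)"
proof
  assume compact: "\<forall>T :: 'e \<Rightarrow>\<^sub>L 'f. order_bounded_operator T \<longrightarrow> order_M_weakly_compact T"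
  \<comment> \<open>The constant sequence \<open>g\<close> turns compactness of the rank one
    operators along \<open>y\<close> into convergence of \<open>f (x n)\<close> times the scalar
    \<open>g y\<close>, which is nonzero and can be cancelled.\<close>
  obtain y :: 'f where y: "0 \<le> y" "y \<noteq> 0"
    using F_nonzero by (metis abs_eq_0 abs_ge_zero)
  obtain g :: "'f \<Rightarrow>\<^sub>L real" where g: "blinfun_apply g y \<noteq> 0" using nonzero_functional[OF y(2)] by blast
  show "order_continuous_norm TYPE('e \<Rightarrow>\<^sub>L real)"
  proof (rule order_continuous_dual_if_disjoint_weakly_null)
    fix f :: "'e \<Rightarrow>\<^sub>L real" and x :: "nat \<Rightarrow> 'e"
    assume x: "disjoint_sequence x" "range x \<subseteq> cball 0 1"
    have "order_M_weakly_compact (blinfun_scaleR_left y o\<^sub>L f)"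
      using compact order_bounded_operator_rank_one[OF y(1)] by blast
    moreover have "order_bounded (range (\<lambda>n::nat. g))" unfolding order_bounded_def by auto
    ultimately have "(\<lambda>n. blinfun_apply g (blinfun_apply (blinfun_scaleR_left y o\<^sub>L f) (x n))) \<longlonglongrightarrow> 0"
      using x unfolding order_M_weakly_compact_def by blast
    then have "(\<lambda>n. blinfun_apply f (x n) * blinfun_apply g y) \<longlonglongrightarrow> 0"
      by (simp add: blinfun.scaleR_right)
    then show "(\<lambda>n. blinfun_apply f (x n)) \<longlonglongrightarrow> 0"
      using tendsto_mult_right_iff[OF g, of "\<lambda>n. blinfun_apply f (x n)" 0] by simp
  qed
qed (use order_M_weakly_compact_if_order_continuous_dual in blast)

end
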